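(* For any $\mathcal F$ (as in the context), if the PSOD or the MSOD is used, then for all $k\ne k'$, $$\mathrm{var}(\hat\tau_{kk'})\le\frac1n\mathrm{var}(Y_{1k}-Y_{1k'})+\frac{(\|f_k\|+\|f_{k'}\|)^2}{2}\Big(1-\frac1m\Big)\mathbb E[M_{\mathrm{opt}}^2]+\frac1n\mathrm{var}(\epsilon_{1k}+\epsilon_{1k'})+\frac{m-2}{n}\{\mathrm{var}(\epsilon_{1k})+\mathrm{var}(\epsilon_{1k'})\},$$ where $M_{\mathrm{opt}}^2=M_{\mathrm{P\text{-}opt}}^2$ or $M_{\mathrm{opt}}^2=M_{\mathrm{M\text{-}opt}}^2$ respectively.
   Context: Setup. There are $m\ge2$ treatments and $n=mp$ subjects; the tuples $(X_i,Y_{i1},\dots,Y_{im})$, $i=1,\dots,n$, are i.i.d., where $X_i\in\mathcal X$ are baseline covariates and $Y_{ik}\in\mathbb R$ is the potential outcome of subject $i$ under treatment $k$, with finite second moment. $X=(X_1,\dots,X_n)$, $Y=(Y_{ik})$; $f_k(x)=\mathbb E[Y_{ik}\mid X_i=x]$, $\epsilon_{ik}=Y_{ik}-f_k(X_i)$. $W\in\{1,\dots,m\}^n$ is the random assignment, drawn according to the design given $X$, independently of $Y$ given $X$. $\hat\tau_{kk'}=\frac1p\sum_{i:W_i=k}Y_{ik}-\frac1p\sum_{i:W_i=k'}Y_{ik'}$. $\mathcal W\subset\{1,\dots,m\}^n$ is the set of assignments with exactly $p$ subjects in each treatment. $\Delta$ is the set of probability distributions $\sigma$ on $\mathcal W$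 with $\sigma((k_1,\dots,k_n))=\sigma((\pi(k_1),\dots,\pi(k_n)))$ for every permutation $\pi$ of $\{1,\dots,m\}$. For $f:\mathcal X\to\mathbb R$, $B_{kl}(W,f)=\frac1p\sum_{i:W_i=k}f(X_i)-\frac1p\sum_{i:W_i=l}f(X_i)$. $\mathcal F$ is a normed vector space of functions $\mathcal X\to\mathbb R$ with norm $\|\cdot\|$, extended by $\|f\|=\infty$ for $f\notin\mathcal F$. Since $B_{kl}(W,f)$ is invariant to adding constants to $f$, one always works modulo constant functions and $\|f\|$ means $\min_{c\in\mathbb R}\|f+c\|$. The resulting space is assumed to be a Banach space on which the evaluation differences $f\mapsto f(X_i)-f(X_j)$ are continuous. When the norm of $f_k$ or $f_{k'}$ is $\infty$, the bound is read as $+\infty$ (trivial). Given $X$: $M_{\mathrm P}^2(W)=\max_{\|f\|\le1}\max_{k\ne k'}B_{kk'}^2(W,f)$ for $W\in\mathcal W$; the pure strategy optimal design (PSOD) draws $W$ uniformly at random from $\arg\min_{W\in\mathcal W}M_{\mathrm P}^2(W)$, and $M_{\mathrm{P\text{-}opt}}^2$ is the (random, $X$-dependent) optimal value. $M_{\mathrm M}^2(\sigma)=\max_{\|f\|\le1}\max_{k\ne k'}\sum_{W\in\mathcal W}\sigma(W)B_{kk'}^2(W,f)$ for $\sigma\in\Delta$; the mixed strategy optimal design (MSOD) draws $W$ from some $\sigma\in\arg\min_{\sigma\in\Delta}M_{\mathrm M}^2(\sigma)$, and $M_{\mathrm{M\text{-}opt}}^2$ is the (random) optimal value. *)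

theory Defs
  imports "HOL-Probability.Probability" "HOL-Combinatorics.Permutations"
begin

section \<open>Function spaces modulo constants\<close>

definition normed_function_space :: "('x \<Rightarrow> real) set \<Rightarrow> (('x \<Rightarrow> real) \<Rightarrow> real) \<Rightarrow> bool" where
  "normed_function_space F nrm \<longleftrightarrow>
     (\<lambda>_. 0) \<in> F \<and>
     (\<forall>g\<in>F. \<forall>h\<in>F. (\<lambda>x. g x + h x) \<in> F) \<and>
     (\<forall>a. \<forall>g\<in>F. (\<lambda>x. a * g x) \<in> F) \<and>
     (\<forall>g\<in>F. 0 \<le> nrm g) \<and>
     (\<forall>g\<in>F. nrm g = 0 \<longleftrightarrow> g = (\<lambda>_. 0)) \<and>
     (\<forall>a. \<forall>g\<in>F. nrm (\<lambda>x. a * g x) = \<bar>a\<bar> * nrm g) \<and>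
     (\<forall>g\<in>F. \<forall>h\<in>F. nrm (\<lambda>x. g x + h x) \<le> nrm g + nrm h)"

definition ext_norm :: "('x \<Rightarrow> real) set \<Rightarrow> (('x \<Rightarrow> real) \<Rightarrow> real) \<Rightarrow> ('x \<Rightarrow> real) \<Rightarrow> ennreal" where
  "ext_norm F nrm g = (if g \<in> F then ennreal (nrm g) else \<infinity>)"

text \<open>
  The infimum below is attained: \<open>F\<close> contains either every constant function or only zero,
  and in the first case the minimum is over a line in a normed space.
\<close>

definition qnorm :: "('x \<Rightarrow> real) set \<Rightarrow> (('x \<Rightarrow> real) \<Rightarrow> real) \<Rightarrow> ('x \<Rightarrow> real) \<Rightarrow> ennreal" where
  "qnorm F nrm g = (INF c. ext_norm F nrm (\<lambda>x. g x + c))"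

text \<open>
  The space modulo constants is handled through representatives: the functions of finite
  \<open>qnorm\<close>, two of them being identified when they differ by a constant.
  Completeness of the quotient and continuity on the quotient are stated with sequences
  of representatives.
\<close>

definition complete_mod_const :: "('x \<Rightarrow> real) set \<Rightarrow> (('x \<Rightarrow> real) \<Rightarrow> real) \<Rightarrow> bool" where
  "complete_mod_const F nrm \<longleftrightarrow>
     (\<forall>g :: nat \<Rightarrow> 'x \<Rightarrow> real.
        (\<forall>i. qnorm F nrm (g i) < \<infinity>) \<and>
        (\<forall>e>0. \<exists>K. \<forall>i\<ge>K. \<forall>j\<ge>K. qnorm F nrm (\<lambda>x. g i x - g j x) < e) \<longrightarrow>
        (\<exists>h. qnorm F nrm h < \<infinity> \<and> (\<lambda>i. qnorm F nrm (\<lambda>x. g i x - h x)) \<longlonglongrightarrow> 0))"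

definition eval_diff_continuous ::
  "('x \<Rightarrow> real) set \<Rightarrow> (('x \<Rightarrow> real) \<Rightarrow> real) \<Rightarrow> 'x \<Rightarrow> 'x \<Rightarrow> bool" where
  "eval_diff_continuous F nrm x y \<longleftrightarrow>
     (\<forall>(g :: nat \<Rightarrow> 'x \<Rightarrow> real) h.
        (\<forall>i. qnorm F nrm (g i) < \<infinity>) \<and> qnorm F nrm h < \<infinity> \<and>
        (\<lambda>i. qnorm F nrm (\<lambda>z. g i z - h z)) \<longlonglongrightarrow> 0 \<longrightarrow>
        (\<lambda>i. g i x - g i y) \<longlonglongrightarrow> h x - h y)"

section \<open>Assignments, imbalance and optimal designs\<close>

text \<open>
  Subjects are \<open>{1..n}\<close> and treatments \<open>{1..m}\<close>. The argument \<open>x\<close> below is the tuple of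
  the \<open>n\<close> observed covariates.
\<close>

definition assignments :: "nat \<Rightarrow> nat \<Rightarrow> (nat \<Rightarrow> nat) set" where
  "assignments m n = {1..n} \<rightarrow>\<^sub>E {1..m}"

definition balanced :: "nat \<Rightarrow> nat \<Rightarrow> nat \<Rightarrow> (nat \<Rightarrow> nat) set" where
  "balanced m p n = {w \<in> assignments m n. \<forall>k\<in>{1..m}. card {i \<in> {1..n}. w i = k} = p}"

definition imbalance ::
  "nat \<Rightarrow> nat \<Rightarrow> (nat \<Rightarrow> 'x) \<Rightarrow> nat \<Rightarrow> nat \<Rightarrow> (nat \<Rightarrow> nat) \<Rightarrow> ('x \<Rightarrow> real) \<Rightarrow> real" where
  "imbalance p n x k l w g =
     1 / real p * (\<Sum>i | i \<in> {1..n} \<and> w i = k. g (x i))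
   - 1 / real p * (\<Sum>i | i \<in> {1..n} \<and> w i = l. g (x i))"

definition treatment_pairs :: "nat \<Rightarrow> (nat \<times> nat) set" where
  "treatment_pairs m = {(k, l). k \<in> {1..m} \<and> l \<in> {1..m} \<and> k \<noteq> l}"

definition MP2 :: "('x \<Rightarrow> real) set \<Rightarrow> (('x \<Rightarrow> real) \<Rightarrow> real) \<Rightarrow> nat \<Rightarrow> nat \<Rightarrow> nat \<Rightarrow>
    (nat \<Rightarrow> 'x) \<Rightarrow> (nat \<Rightarrow> nat) \<Rightarrow> ennreal" where
  "MP2 F nrm m p n x w =
     (SUP g \<in> {g. qnorm F nrm g \<le> 1}. SUP (k, l) \<in> treatment_pairs m.
        ennreal ((imbalance p n x k l w g)\<^sup>2))"

definition MP2_opt :: "('x \<Rightarrow> real) set \<Rightarrow> (('x \<Rightarrow> real) \<Rightarrow> real) \<Rightarrow> nat \<Rightarrow> nat \<Rightarrow> nat \<Rightarrow>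
    (nat \<Rightarrow> 'x) \<Rightarrow> ennreal" where
  "MP2_opt F nrm m p n x = (INF w \<in> balanced m p n. MP2 F nrm m p n x w)"

definition PSOD :: "('x \<Rightarrow> real) set \<Rightarrow> (('x \<Rightarrow> real) \<Rightarrow> real) \<Rightarrow> nat \<Rightarrow> nat \<Rightarrow> nat \<Rightarrow>
    (nat \<Rightarrow> 'x) \<Rightarrow> (nat \<Rightarrow> nat) pmf" where
  "PSOD F nrm m p n x =
     pmf_of_set {w \<in> balanced m p n. \<forall>w' \<in> balanced m p n. MP2 F nrm m p n x w \<le> MP2 F nrm m p n x w'}"

definition mixed_strategies :: "nat \<Rightarrow> nat \<Rightarrow> nat \<Rightarrow> (nat \<Rightarrow> nat) pmf set" where
  "mixed_strategies m p n =
     {\<sigma>. set_pmf \<sigma> \<subseteq> balanced m p n \<and>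
         (\<forall>\<pi>. \<pi> permutes {1..m} \<longrightarrow>
            (\<forall>w \<in> balanced m p n. pmf \<sigma> w = pmf \<sigma> (\<lambda>i\<in>{1..n}. \<pi> (w i))))}"

definition MM2 :: "('x \<Rightarrow> real) set \<Rightarrow> (('x \<Rightarrow> real) \<Rightarrow> real) \<Rightarrow> nat \<Rightarrow> nat \<Rightarrow> nat \<Rightarrow>
    (nat \<Rightarrow> 'x) \<Rightarrow> (nat \<Rightarrow> nat) pmf \<Rightarrow> ennreal" where
  "MM2 F nrm m p n x \<sigma> =
     (SUP g \<in> {g. qnorm F nrm g \<le> 1}. SUP (k, l) \<in> treatment_pairs m.
        ennreal (\<Sum>w \<in> balanced m p n. pmf \<sigma> w * (imbalance p n x k l w g)\<^sup>2))"

definition MM2_opt :: "('x \<Rightarrow> real) set \<Rightarrow> (('x \<Rightarrow> real) \<Rightarrow> real) \<Rightarrow> nat \<Rightarrow> nat \<Rightarrow> nat \<Rightarrow>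
    (nat \<Rightarrow> 'x) \<Rightarrow> ennreal" where
  "MM2_opt F nrm m p n x = (INF \<sigma> \<in> mixed_strategies m p n. MM2 F nrm m p n x \<sigma>)"

definition MSODs :: "('x \<Rightarrow> real) set \<Rightarrow> (('x \<Rightarrow> real) \<Rightarrow> real) \<Rightarrow> nat \<Rightarrow> nat \<Rightarrow> nat \<Rightarrow>
    (nat \<Rightarrow> 'x) \<Rightarrow> (nat \<Rightarrow> nat) pmf set" where
  "MSODs F nrm m p n x =
     {\<sigma> \<in> mixed_strategies m p n. \<forall>\<sigma>' \<in> mixed_strategies m p n. MM2 F nrm m p n x \<sigma> \<le> MM2 F nrm m p n x \<sigma>'}"

section \<open>The probabilistic model\<close>

definition generated :: "'a measure \<Rightarrow> ('a \<Rightarrow> 'b) \<Rightarrow> 'b measure \<Rightarrow> 'a measure" where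
  "generated M Z S = vimage_algebra (space M) Z S"

definition cond_prob_given :: "'a measure \<Rightarrow> 'a measure \<Rightarrow> 'a set \<Rightarrow> 'a \<Rightarrow> real" where
  "cond_prob_given M G A = real_cond_exp M G (indicator A)"

definition cond_indep :: "'a measure \<Rightarrow> 'a measure \<Rightarrow> 'a measure \<Rightarrow> 'a measure \<Rightarrow> bool" where
  "cond_indep M G A B \<longleftrightarrow>
     (\<forall>a \<in> sets A. \<forall>b \<in> sets B. AE \<omega> in M.
        cond_prob_given M G (a \<inter> b) \<omega> = cond_prob_given M G a \<omega> * cond_prob_given M G b \<omega>)"

definition covariates :: "nat \<Rightarrow> (nat \<Rightarrow> 'a \<Rightarrow> 'x) \<Rightarrow> 'a \<Rightarrow> nat \<Rightarrow> 'x" where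
  "covariates n X \<omega> = (\<lambda>i\<in>{1..n}. X i \<omega>)"

definition outcomes :: "nat \<Rightarrow> (nat \<Rightarrow> nat \<Rightarrow> 'a \<Rightarrow> real) \<Rightarrow> nat \<Rightarrow> 'a \<Rightarrow> nat \<Rightarrow> real" where
  "outcomes m Y i \<omega> = (\<lambda>k\<in>{1..m}. Y i k \<omega>)"

definition all_outcomes ::
  "nat \<Rightarrow> nat \<Rightarrow> (nat \<Rightarrow> nat \<Rightarrow> 'a \<Rightarrow> real) \<Rightarrow> 'a \<Rightarrow> nat \<Rightarrow> nat \<Rightarrow> real" where
  "all_outcomes m n Y \<omega> = (\<lambda>i\<in>{1..n}. outcomes m Y i \<omega>)"

definition outcome_space :: "nat \<Rightarrow> (nat \<Rightarrow> real) measure" where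
  "outcome_space m = PiM {1..m} (\<lambda>_. borel)"

definition iid_subjects :: "'a measure \<Rightarrow> 'x measure \<Rightarrow> nat \<Rightarrow> nat \<Rightarrow>
    (nat \<Rightarrow> 'a \<Rightarrow> 'x) \<Rightarrow> (nat \<Rightarrow> nat \<Rightarrow> 'a \<Rightarrow> real) \<Rightarrow> bool" where
  "iid_subjects M N m n X Y \<longleftrightarrow>
     prob_space.indep_vars M (\<lambda>_. N \<Otimes>\<^sub>M outcome_space m) (\<lambda>i \<omega>. (X i \<omega>, outcomes m Y i \<omega>)) {1..n} \<and>
     (\<forall>i\<in>{1..n}. \<forall>j\<in>{1..n}.
        distr M (N \<Otimes>\<^sub>M outcome_space m) (\<lambda>\<omega>. (X i \<omega>, outcomes m Y i \<omega>)) =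
        distr M (N \<Otimes>\<^sub>M outcome_space m) (\<lambda>\<omega>. (X j \<omega>, outcomes m Y j \<omega>)))"

text \<open>\<open>g\<close> is a version of \<open>x \<mapsto> E[Z | V = x]\<close>.\<close>

definition regression_function ::
  "'a measure \<Rightarrow> 'x measure \<Rightarrow> ('a \<Rightarrow> real) \<Rightarrow> ('a \<Rightarrow> 'x) \<Rightarrow> ('x \<Rightarrow> real) \<Rightarrow> bool" where
  "regression_function M N Z V g \<longleftrightarrow>
     g \<in> borel_measurable N \<and> (AE \<omega> in M. real_cond_exp M (generated M V N) Z \<omega> = g (V \<omega>))"

text \<open>
  \<open>D x\<close> is the law of the assignment when the covariate tuple is \<open>x\<close>.
\<close>

definition drawn_from_design :: "'a measure \<Rightarrow> 'x measure \<Rightarrow> nat \<Rightarrow> nat \<Rightarrow>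
    (nat \<Rightarrow> 'a \<Rightarrow> 'x) \<Rightarrow> (nat \<Rightarrow> nat \<Rightarrow> 'a \<Rightarrow> real) \<Rightarrow> ('a \<Rightarrow> nat \<Rightarrow> nat) \<Rightarrow>
    ((nat \<Rightarrow> 'x) \<Rightarrow> (nat \<Rightarrow> nat) pmf) \<Rightarrow> bool" where
  "drawn_from_design M N m n X Y W D \<longleftrightarrow>
     W \<in> measurable M (count_space (assignments m n)) \<and>
     (let G = generated M (covariates n X) (PiM {1..n} (\<lambda>_. N)) in
       (\<forall>w \<in> assignments m n. AE \<omega> in M.
          cond_prob_given M G {\<omega> \<in> space M. W \<omega> = w} \<omega> = pmf (D (covariates n X \<omega>)) w) \<and>
       cond_indep M G
         (generated M W (count_space (assignments m n)))
         (generated M (all_outcomes m n Y) (PiM {1..n} (\<lambda>_. outcome_space m))))"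

definition tau_hat :: "nat \<Rightarrow> nat \<Rightarrow> (nat \<Rightarrow> nat \<Rightarrow> 'a \<Rightarrow> real) \<Rightarrow> ('a \<Rightarrow> nat \<Rightarrow> nat) \<Rightarrow>
    nat \<Rightarrow> nat \<Rightarrow> 'a \<Rightarrow> real" where
  "tau_hat p n Y W k k' \<omega> =
     1 / real p * (\<Sum>i | i \<in> {1..n} \<and> W \<omega> i = k. Y i k \<omega>)
   - 1 / real p * (\<Sum>i | i \<in> {1..n} \<and> W \<omega> i = k'. Y i k' \<omega>)"

definition residual :: "(nat \<Rightarrow> 'a \<Rightarrow> 'x) \<Rightarrow> (nat \<Rightarrow> nat \<Rightarrow> 'a \<Rightarrow> real) \<Rightarrow> (nat \<Rightarrow> 'x \<Rightarrow> real) \<Rightarrow>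
    nat \<Rightarrow> nat \<Rightarrow> 'a \<Rightarrow> real" where
  "residual X Y f i k \<omega> = Y i k \<omega> - f k (X i \<omega>)"

text \<open>
  The case distinction is needed because \<open>\<infinity> * 0 = 0\<close> in \<open>ennreal\<close>; an infinite norm must make
  the whole bound infinite. The expectation of \<open>Mopt2\<close>, which may be infinite, is an
  \<open>ennreal\<close>-valued integral.
\<close>

definition variance_bound :: "'a measure \<Rightarrow> ('x \<Rightarrow> real) set \<Rightarrow> (('x \<Rightarrow> real) \<Rightarrow> real) \<Rightarrow> nat \<Rightarrow> nat \<Rightarrow>
    (nat \<Rightarrow> 'a \<Rightarrow> 'x) \<Rightarrow> (nat \<Rightarrow> nat \<Rightarrow> 'a \<Rightarrow> real) \<Rightarrow> (nat \<Rightarrow> 'x \<Rightarrow> real) \<Rightarrow> ('a \<Rightarrow> ennreal) \<Rightarrow>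
    nat \<Rightarrow> nat \<Rightarrow> ennreal" where
  "variance_bound M F nrm m n X Y f Mopt2 k k' =
     (if qnorm F nrm (f k) = \<infinity> \<or> qnorm F nrm (f k') = \<infinity> then \<infinity>
      else
        ennreal (1 / real n * prob_space.variance M (\<lambda>\<omega>. Y 1 k \<omega> - Y 1 k' \<omega>))
      + (qnorm F nrm (f k) + qnorm F nrm (f k'))\<^sup>2 / 2 * ennreal (1 - 1 / real m)
          * (\<integral>\<^sup>+\<omega>. Mopt2 \<omega> \<partial>M)
      + ennreal (1 / real n *
          prob_space.variance M (\<lambda>\<omega>. residual X Y f 1 k \<omega> + residual X Y f 1 k' \<omega>))
      + ennreal ((real m - 2) / real n *
          (prob_space.variance M (residual X Y f 1 k) + prob_space.variance M (residual X Y f 1 k'))))"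

end

theory Submission
  imports Defs
begin

text \<open>
  Relabelling the treatments leaves the law of the assignment unchanged, given the covariates, both
  under a uniform draw from the minimisers of \<open>MP2\<close> and under any strategy in
  \<open>mixed_strategies\<close>. Hence each subject receives each treatment with probability \<open>1/m\<close>, and
  every deviation of a group mean from the sample mean has conditional mean zero.

  Write each outcome as \<open>Y\<^sub>i\<^sub>k = f\<^sub>k(X\<^sub>i) + \<epsilon>\<^sub>i\<^sub>k\<close>, and let \<open>\<mu>\<close> be the mean of
  \<open>f\<^sub>k(X\<^sub>1) - f\<^sub>k\<^sub>'(X\<^sub>1)\<close>. For a fixed assignment \<open>w\<close> the estimator minus \<open>\<mu>\<close> is a sum of three
  terms: the imbalance, that is the deviation of the mean of \<open>f\<^sub>k\<close> in group \<open>k\<close> from its sample mean,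
  minus the same for \<open>f\<^sub>k\<^sub>'\<close> and \<open>k'\<close>; the centered sample mean of \<open>f\<^sub>k - f\<^sub>k\<^sub>'\<close>; and the
  noise, a combination of the residuals. Averaged over \<open>w\<close> and the data, the cross terms vanish: the
  first two are uncorrelated by symmetry of the design, and a residual is orthogonal to everything that
  depends on the covariates and the other subjects only (\<open>eps_orthogonal\<close>). Three second moments
  remain.

  The sample mean contributes \<open>var(f\<^sub>k(X\<^sub>1) - f\<^sub>k\<^sub>'(X\<^sub>1))/n\<close>, by independence of the subjects. The noise
  contributes \<open>(var \<epsilon>\<^sub>1\<^sub>k + var \<epsilon>\<^sub>1\<^sub>k\<^sub>')/p\<close>, because treatments are assigned with probability \<open>1/m\<close>.
  The two together are exactly the three terms of the bound that do not involve the design, by the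
  parallelogram identity
  \<open>var(\<epsilon>\<^sub>1\<^sub>k - \<epsilon>\<^sub>1\<^sub>k\<^sub>') + var(\<epsilon>\<^sub>1\<^sub>k + \<epsilon>\<^sub>1\<^sub>k\<^sub>') = 2(var \<epsilon>\<^sub>1\<^sub>k + var \<epsilon>\<^sub>1\<^sub>k\<^sub>')\<close> and \<open>1/p = m/n\<close>
  (\<open>variance_effect_plus_variance_noise\<close>).

  For the imbalance, the \<open>m\<close> group deviations of a function \<open>g\<close> add up to zero and, by symmetry, have
  equal second moments. Therefore the squared imbalances, summed over all ordered pairs of treatments, are
  \<open>2 m\<^sup>2\<close> times the second moment of one deviation. If each squared imbalance is at most
  \<open>\<parallel>g\<parallel>\<^sup>2 M\<close> on average, a deviation has second moment at most \<open>(1 - 1/m)/2 \<cdot> \<parallel>g\<parallel>\<^sup>2 M\<close>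
  (\<open>design_variance_group_deviation_le\<close>). Minkowski's inequality for the two groups gives
  \<open>(\<parallel>f\<^sub>k\<parallel> + \<parallel>f\<^sub>k\<^sub>'\<parallel>)\<^sup>2\<close> in place of \<open>\<parallel>g\<parallel>\<^sup>2\<close> (\<open>group_deviation_difference_le\<close>). For \<open>M\<close> one may take the
  optimal value, as an optimal design attains it (\<open>PSOD_controls_imbalance\<close>,
  \<open>MSOD_controls_imbalance\<close>).
\<close>

section \<open>The norm modulo constants\<close>

lemma qnorm_cmult_le:
  assumes F: "normed_function_space F nrm" and a: "a > 0"
  shows "qnorm F nrm (\<lambda>x. a * g x) \<le> ennreal a * qnorm F nrm g"
proof -
  \<comment> \<open>Dividing by \<open>a\<close> makes the infimum the upper side, so that it suffices to compare with each shift.\<close>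
  have "ennreal (1 / a) * qnorm F nrm (\<lambda>x. a * g x) \<le> ext_norm F nrm (\<lambda>x. g x + c)" for c
  proof (cases "(\<lambda>x. g x + c) \<in> F")
    case True
    have scaled: "(\<lambda>x. a * (g x + c)) \<in> F" "nrm (\<lambda>x. a * (g x + c)) = a * nrm (\<lambda>x. g x + c)"
      and nonneg: "0 \<le> nrm (\<lambda>x. g x + c)"
      using F True a unfolding normed_function_space_def by auto
    have "qnorm F nrm (\<lambda>x. a * g x) \<le> ext_norm F nrm (\<lambda>x. a * g x + a * c)"
      unfolding qnorm_def by (rule INF_lower) simp
    also have "\<dots> = ennreal (a * nrm (\<lambda>x. g x + c))"
      using scaled by (simp add: ext_norm_def distrib_left)
    finally have "ennreal (1 / a) * qnorm F nrm (\<lambda>x. a * g x)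
        \<le> ennreal (1 / a) * ennreal (a * nrm (\<lambda>x. g x + c))"
      by (rule mult_left_mono) simp
    also have "\<dots> = ennreal (nrm (\<lambda>x. g x + c))"
      using a nonneg by (simp add: ennreal_mult[symmetric])
    finally show ?thesis using True by (simp add: ext_norm_def)
  qed (simp add: ext_norm_def)
  then have "ennreal (1 / a) * qnorm F nrm (\<lambda>x. a * g x) \<le> qnorm F nrm g"
    unfolding qnorm_def[of F nrm g] by (rule INF_greatest)
  then have "ennreal a * (ennreal (1 / a) * qnorm F nrm (\<lambda>x. a * g x)) \<le> ennreal a * qnorm F nrm g"
    by (rule mult_left_mono) simp
  moreover have "ennreal a * (ennreal (1 / a) * z) = z" for z
    using a by (simp add: mult.assoc[symmetric] ennreal_mult[symmetric])
  ultimately show ?thesis by simp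
qed

text \<open>
  A function of norm zero modulo constants need not lie in \<open>F\<close>, but the constant sequence at it
  converges to the zero function, and continuity of the evaluation difference at zero settles the rest.
\<close>

lemma qnorm_eq_0_imp_equal_values:
  assumes F: "normed_function_space F nrm" and xy: "eval_diff_continuous F nrm x y"
    and g: "qnorm F nrm g = 0"
  shows "g x = g y"
proof -
  have "qnorm F nrm (\<lambda>_. 0) \<le> ext_norm F nrm (\<lambda>_. 0 + 0)"
    unfolding qnorm_def by (rule INF_lower) simp
  also have "\<dots> < \<infinity>"
    using F by (simp add: ext_norm_def normed_function_space_def)
  finally have "(\<lambda>i::nat. g x - g y) \<longlonglongrightarrow> 0 - 0"
    using xy[unfolded eval_diff_continuous_def, rule_format, of "\<lambda>_. g" "\<lambda>_. 0"] g by simp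
  then show ?thesis
    by (simp add: LIMSEQ_const_iff)
qed

section \<open>Symmetric designs\<close>

abbreviation design_mean :: "nat \<Rightarrow> nat \<Rightarrow> nat \<Rightarrow> (nat \<Rightarrow> nat) pmf \<Rightarrow> ((nat \<Rightarrow> nat) \<Rightarrow> real) \<Rightarrow> real"
  where "design_mean m p n \<sigma> \<Psi> \<equiv> \<Sum>w\<in>balanced m p n. pmf \<sigma> w * \<Psi> w"

definition group_mean :: "nat \<Rightarrow> nat \<Rightarrow> (nat \<Rightarrow> 'x) \<Rightarrow> (nat \<Rightarrow> nat) \<Rightarrow> ('x \<Rightarrow> real) \<Rightarrow> nat \<Rightarrow> real" where
  "group_mean p n x w g k = 1 / real p * (\<Sum>i | i \<in> {1..n} \<and> w i = k. g (x i))"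

definition group_deviation :: "nat \<Rightarrow> nat \<Rightarrow> (nat \<Rightarrow> 'x) \<Rightarrow> (nat \<Rightarrow> nat) \<Rightarrow> ('x \<Rightarrow> real) \<Rightarrow> nat \<Rightarrow> real" where
  "group_deviation p n x w g k = group_mean p n x w g k - (\<Sum>i=1..n. g (x i)) / real n"

text \<open>
  The action of treatment permutations on assignments under which mixed strategies are invariant.
\<close>

definition relabel :: "nat \<Rightarrow> (nat \<Rightarrow> nat) \<Rightarrow> (nat \<Rightarrow> nat) \<Rightarrow> nat \<Rightarrow> nat" where
  "relabel n \<pi> w = (\<lambda>i\<in>{1..n}. \<pi> (w i))"

lemma imbalance_eq_group_means:
  "imbalance p n x k l w g = group_mean p n x w g k - group_mean p n x w g l"
  by (simp add: imbalance_def group_mean_def)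

lemma finite_balanced: "finite (balanced m p n)"
  unfolding balanced_def assignments_def by (rule finite_subset[of _ "{1..n} \<rightarrow>\<^sub>E {1..m}"])
    (auto intro: finite_PiE)

lemma balancedD:
  assumes "w \<in> balanced m p n"
  shows "i \<in> {1..n} \<Longrightarrow> w i \<in> {1..m}" "k \<in> {1..m} \<Longrightarrow> card {i \<in> {1..n}. w i = k} = p"
  using assms by (auto simp: balanced_def assignments_def)

lemma balanced_nonempty:
  assumes "p \<ge> 1" "n = m * p"
  shows "balanced m p n \<noteq> {}"
proof -
  \<comment> \<open>Consecutive blocks of \<open>p\<close> subjects receive the same treatment.\<close>
  let ?w = "\<lambda>i\<in>{1..n}. (i - 1) div p + 1"
  have range: "(i - 1) div p + 1 \<in> {1..m}" if "i \<in> {1..n}" for i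
    using that assms by (auto simp: Suc_le_eq less_mult_imp_div_less)
  have "{i \<in> {1..n}. ?w i = k} = {(k - 1) * p + 1..k * p}" if "k \<in> {1..m}" for k
  proof (intro set_eqI)
    fix i
    have "k * p \<le> n" using that assms by simp
    moreover have "(i - 1) div p = k - 1 \<longleftrightarrow> (k - 1) * p + 1 \<le> i \<and> i \<le> k * p" if "1 \<le> i"
    proof -
      have "(i - 1) div p = k - 1 \<longleftrightarrow> (k - 1) * p \<le> i - 1 \<and> i - 1 < Suc (k - 1) * p"
        using assms div_times_less_eq_dividend[of "i - 1" p] dividend_less_div_times[of p "i - 1"]
        by (metis div_nat_eqI gr_zeroI mult.commute mult_Suc not_one_le_zero)
      moreover have "Suc (k - 1) = k" using \<open>k \<in> {1..m}\<close> by simp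
      ultimately show ?thesis using that by (simp add: less_eq_Suc_le) linarith
    qed
    ultimately show "i \<in> {i \<in> {1..n}. ?w i = k} \<longleftrightarrow> i \<in> {(k - 1) * p + 1..k * p}"
      using that by auto
  qed
  moreover have "card {(k - 1) * p + 1..k * p} = p" if "k \<in> {1..m}" for k
    using that by (cases k) auto
  ultimately have "?w \<in> balanced m p n"
    using range by (auto simp: balanced_def assignments_def)
  then show ?thesis by blast
qed

lemma relabel_group:
  assumes "\<pi> permutes {1..m}"
  shows "{i. i \<in> {1..n} \<and> relabel n \<pi> w i = \<pi> k} = {i. i \<in> {1..n} \<and> w i = k}"
  using permutes_inj[OF assms] by (auto simp: relabel_def dest: injD)

lemma relabel_balanced:
  assumes \<pi>: "\<pi> permutes {1..m}" and w: "w \<in> balanced m p n"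
  shows "relabel n \<pi> w \<in> balanced m p n"
proof -
  have "card {i \<in> {1..n}. relabel n \<pi> w i = k} = p" if "k \<in> {1..m}" for k
  proof -
    have "inv \<pi> k \<in> {1..m}"
      using permutes_in_image[OF permutes_inv[OF \<pi>]] that by blast
    moreover have "\<pi> (inv \<pi> k) = k"
      using permutes_inverses(1)[OF \<pi>] .
    ultimately show ?thesis
      using relabel_group[OF \<pi>, of n w "inv \<pi> k"] balancedD(2)[OF w] by simp
  qed
  moreover have "relabel n \<pi> w \<in> assignments m n"
    using balancedD(1)[OF w] permutes_in_image[OF \<pi>]
    unfolding relabel_def assignments_def by (intro restrict_PiE_iff[THEN iffD2]) blast
  ultimately show ?thesis by (simp add: balanced_def)
qed

lemma relabel_inv:
  assumes \<pi>: "\<pi> permutes {1..m}" and w: "w \<in> balanced m p n"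
  shows "relabel n (inv \<pi>) (relabel n \<pi> w) = w" "relabel n \<pi> (relabel n (inv \<pi>) w) = w"
proof -
  have "w \<in> extensional {1..n}"
    using w unfolding balanced_def assignments_def PiE_def by blast
  then show "relabel n (inv \<pi>) (relabel n \<pi> w) = w" "relabel n \<pi> (relabel n (inv \<pi>) w) = w"
    using permutes_inverses[OF \<pi>] by (auto simp: relabel_def restrict_def extensional_def fun_eq_iff)
qed

lemma bij_betw_relabel:
  assumes "\<pi> permutes {1..m}"
  shows "bij_betw (relabel n \<pi>) (balanced m p n) (balanced m p n)"
  using relabel_inv[OF assms] relabel_balanced[OF assms] relabel_balanced[OF permutes_inv[OF assms]]
  by (intro bij_betw_byWitness[where f' = "relabel n (inv \<pi>)"]) auto

lemma group_mean_relabel: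
  assumes "\<pi> permutes {1..m}"
  shows "group_mean p n x (relabel n \<pi> w) g (\<pi> k) = group_mean p n x w g k"
  by (simp only: group_mean_def relabel_group[OF assms])

lemma sum_over_groups:
  assumes w: "w \<in> balanced m p n"
  shows "(\<Sum>k=1..m. \<Sum>i | i \<in> {1..n} \<and> w i = k. h i) = (\<Sum>i=1..n. h i :: real)"
proof -
  have "w ` {1..n} \<subseteq> {1..m}" using balancedD(1)[OF w] by blast
  from sum.group[OF _ _ this, of h] show ?thesis by simp
qed

lemma sum_group_deviation:
  assumes "p \<ge> 1" "n = m * p" and w: "w \<in> balanced m p n"
  shows "(\<Sum>k=1..m. group_deviation p n x w g k) = 0"
proof (cases "m = 0")
  case False
  then show ?thesis
    using assms sum_over_groups[OF w, of "\<lambda>i. g (x i)"]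
    by (simp add: group_deviation_def group_mean_def sum_subtractf sum_distrib_left[symmetric] sum_divide_distrib[symmetric])
qed simp

lemma pmf_design_sum:
  assumes "\<sigma> \<in> mixed_strategies m p n"
  shows "(\<Sum>w\<in>balanced m p n. pmf \<sigma> w) = 1"
  using assms sum_pmf_eq_1[OF finite_balanced, of \<sigma>] by (auto simp: mixed_strategies_def)

text \<open>
  Transposing two treatments shows that an equivariant family of statistics has the same mean at every
  treatment, so that each of these means is a fraction \<open>1/m\<close> of the mean of their sum.
\<close>

lemma symmetric_design_mean:
  assumes \<sigma>: "\<sigma> \<in> mixed_strategies m p n" and k: "k \<in> {1..m}"
    and equivariant: "\<And>\<pi> l w. \<pi> permutes {1..m} \<Longrightarrow> \<Psi> (\<pi> l) (relabel n \<pi> w) = \<Psi> l w"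
  shows "real m * design_mean m p n \<sigma> (\<Psi> k) = design_mean m p n \<sigma> (\<lambda>w. \<Sum>l=1..m. \<Psi> l w)"
proof -
  have eq: "design_mean m p n \<sigma> (\<Psi> l) = design_mean m p n \<sigma> (\<Psi> k)" if l: "l \<in> {1..m}" for l
  proof -
    define \<pi> where "\<pi> = Transposition.transpose k l"
    have \<pi>: "\<pi> permutes {1..m}" "\<pi> k = l"
      using permutes_swap_id[OF k l] by (simp_all add: \<pi>_def)
    have "design_mean m p n \<sigma> (\<Psi> l)
        = (\<Sum>w\<in>balanced m p n. pmf \<sigma> (relabel n \<pi> w) * \<Psi> l (relabel n \<pi> w))"
      by (rule sum.reindex_bij_betw[OF bij_betw_relabel[OF \<pi>(1)], symmetric])
    also have "\<dots> = design_mean m p n \<sigma> (\<Psi> k)"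
    proof (rule sum.cong[OF refl])
      fix w assume "w \<in> balanced m p n"
      then have "pmf \<sigma> w = pmf \<sigma> (relabel n \<pi> w)"
        using \<sigma> \<pi>(1) by (auto simp: mixed_strategies_def relabel_def)
      moreover have "\<Psi> l (relabel n \<pi> w) = \<Psi> k w"
        using equivariant[OF \<pi>(1), of k w] \<pi>(2) by simp
      ultimately show "pmf \<sigma> (relabel n \<pi> w) * \<Psi> l (relabel n \<pi> w) = pmf \<sigma> w * \<Psi> k w"
        by simp
    qed
    finally show ?thesis .
  qed
  have "design_mean m p n \<sigma> (\<lambda>w. \<Sum>l=1..m. \<Psi> l w) = (\<Sum>l=1..m. design_mean m p n \<sigma> (\<Psi> l))"
    unfolding sum_distrib_left by (rule sum.swap)
  also have "\<dots> = (\<Sum>l=1..m. design_mean m p n \<sigma> (\<Psi> k))"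
    by (rule sum.cong) (use eq in auto)
  finally show ?thesis by simp
qed

lemma design_treatment_probability:
  assumes \<sigma>: "\<sigma> \<in> mixed_strategies m p n" and k: "k \<in> {1..m}" and i: "i \<in> {1..n}"
  shows "design_mean m p n \<sigma> (\<lambda>w. of_bool (w i = k)) = 1 / real m"
proof -
  have "real m * design_mean m p n \<sigma> (\<lambda>w. of_bool (w i = k))
      = design_mean m p n \<sigma> (\<lambda>w. \<Sum>l=1..m. of_bool (w i = l))"
  proof (rule symmetric_design_mean[OF \<sigma> k])
    fix \<pi> l w assume \<pi>: "\<pi> permutes {1..m}"
    show "(of_bool (relabel n \<pi> w i = \<pi> l) :: real) = of_bool (w i = l)"
      using i injD[OF permutes_inj[OF \<pi>]] by (auto simp: relabel_def)
  qed
  also have "\<dots> = (\<Sum>w\<in>balanced m p n. pmf \<sigma> w)"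
  proof (rule sum.cong[OF refl])
    fix w assume "w \<in> balanced m p n"
    then have "w i \<in> {1..m}" using balancedD(1) i by blast
    then show "pmf \<sigma> w * (\<Sum>l=1..m. of_bool (w i = l)) = pmf \<sigma> w"
      by (simp add: of_bool_def)
  qed
  also have "\<dots> = 1" using pmf_design_sum[OF \<sigma>] .
  finally show ?thesis using k by (simp add: field_simps)
qed

lemma design_mean_group_deviation:
  assumes "p \<ge> 1" "n = m * p" and \<sigma>: "\<sigma> \<in> mixed_strategies m p n" and k: "k \<in> {1..m}"
  shows "design_mean m p n \<sigma> (\<lambda>w. group_deviation p n x w g k) = 0"
proof -
  have "real m * design_mean m p n \<sigma> (\<lambda>w. group_deviation p n x w g k)
      = design_mean m p n \<sigma> (\<lambda>w. \<Sum>l=1..m. group_deviation p n x w g l)"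
    by (rule symmetric_design_mean[OF \<sigma> k]) (simp add: group_deviation_def group_mean_relabel)
  also have "\<dots> = 0"
    by (intro sum.neutral ballI) (simp only: sum_group_deviation[OF assms(1,2)] mult_zero_right)
  finally show ?thesis using k by simp
qed

lemma sum_square_differences:
  fixes a :: "nat \<Rightarrow> real"
  assumes "(\<Sum>k=1..m. a k) = 0"
  shows "(\<Sum>k=1..m. \<Sum>l=1..m. (a k - a l)\<^sup>2) = 2 * real m * (\<Sum>k=1..m. (a k)\<^sup>2)"
proof -
  have "(\<Sum>k=1..m. \<Sum>l=1..m. (a k - a l)\<^sup>2)
      = (\<Sum>k=1..m. \<Sum>l=1..m. (a k)\<^sup>2 + (a l)\<^sup>2 - 2 * (a k * a l))"
    by (simp add: power2_diff algebra_simps)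
  also have "\<dots> = 2 * real m * (\<Sum>k=1..m. (a k)\<^sup>2) - 2 * (\<Sum>k=1..m. a k * (\<Sum>l=1..m. a l))"
    by (simp add: sum.distrib sum_subtractf sum_distrib_left algebra_simps)
  finally show ?thesis using assms by simp
qed

text \<open>
  Only the \<open>m (m - 1)\<close> off-diagonal pairs contribute to the sum of squared imbalances, whereas the sum
  equals \<open>2 m\<^sup>2\<close> times the variance of one deviation. The quotient is the constant \<open>(1 - 1/m)/2\<close>.
\<close>

lemma design_variance_group_deviation_le:
  assumes "p \<ge> 1" "n = m * p" and \<sigma>: "\<sigma> \<in> mixed_strategies m p n" and k: "k \<in> {1..m}"
    and b: "\<And>k l. k \<in> {1..m} \<Longrightarrow> l \<in> {1..m} \<Longrightarrow> k \<noteq> l \<Longrightarrow>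
      design_mean m p n \<sigma> (\<lambda>w. (imbalance p n x k l w g)\<^sup>2) \<le> b"
  shows "design_mean m p n \<sigma> (\<lambda>w. (group_deviation p n x w g k)\<^sup>2) \<le> (1 - 1 / real m) / 2 * b"
proof -
  let ?d = "\<lambda>w l. group_deviation p n x w g l"
  let ?s = "design_mean m p n \<sigma> (\<lambda>w. (?d w k)\<^sup>2)"
  have m: "real m > 0" using k by simp
  have "real m * ?s = design_mean m p n \<sigma> (\<lambda>w. \<Sum>l=1..m. (?d w l)\<^sup>2)"
    by (rule symmetric_design_mean[OF \<sigma> k]) (simp add: group_deviation_def group_mean_relabel)
  then have "2 * real m * (real m * ?s) = design_mean m p n \<sigma> (\<lambda>w. 2 * real m * (\<Sum>l=1..m. (?d w l)\<^sup>2))"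
    by (simp add: sum_distrib_left mult_ac)
  also have "\<dots> = design_mean m p n \<sigma> (\<lambda>w. \<Sum>j=1..m. \<Sum>l=1..m. (imbalance p n x j l w g)\<^sup>2)"
  proof (rule sum.cong[OF refl])
    fix w assume w: "w \<in> balanced m p n"
    show "pmf \<sigma> w * (2 * real m * (\<Sum>l=1..m. (?d w l)\<^sup>2))
        = pmf \<sigma> w * (\<Sum>j=1..m. \<Sum>l=1..m. (imbalance p n x j l w g)\<^sup>2)"
      using sum_square_differences[OF sum_group_deviation[OF assms(1,2) w, of x g]]
      by (simp add: imbalance_eq_group_means group_deviation_def)
  qed
  also have "\<dots> = (\<Sum>j=1..m. \<Sum>l=1..m. design_mean m p n \<sigma> (\<lambda>w. (imbalance p n x j l w g)\<^sup>2))"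
    unfolding sum_distrib_left by (subst sum.swap, rule sum.cong[OF refl], rule sum.swap)
  also have "\<dots> \<le> (\<Sum>j=1..m. \<Sum>l=1..m. if j = l then 0 else b)"
    using b by (intro sum_mono) (auto simp: imbalance_eq_group_means)
  also have "\<dots> = (\<Sum>j=1..m. (real m - 1) * b)"
  proof (rule sum.cong[OF refl])
    fix j assume "j \<in> {1..m}"
    have "(\<Sum>l=1..m. if j = l then 0 else b) = (\<Sum>l=1..m. b - (if j = l then b else 0))"
      by (rule sum.cong) auto
    also have "\<dots> = (real m - 1) * b"
      using \<open>j \<in> {1..m}\<close> by (simp add: sum_subtractf algebra_simps)
    finally show "(\<Sum>l=1..m. if j = l then 0 else b) = (real m - 1) * b" .
  qed
  also have "\<dots> = real m * ((real m - 1) * b)" by simp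
  finally have "2 * real m * ?s \<le> (real m - 1) * b"
    using m by (simp add: mult.left_commute)
  then show ?thesis using m by (simp add: field_simps)
qed

text \<open>
  The triangle inequality of the Euclidean norm, with the square roots of the probabilities as
  coordinate weights.
\<close>

lemma design_minkowski:
  assumes "sqrt (design_mean m p n \<sigma> (\<lambda>w. (u w)\<^sup>2)) \<le> a" "sqrt (design_mean m p n \<sigma> (\<lambda>w. (v w)\<^sup>2)) \<le> b"
  shows "design_mean m p n \<sigma> (\<lambda>w. (u w - v w)\<^sup>2) \<le> (a + b)\<^sup>2"
proof -
  have L2: "L2_set (\<lambda>w. sqrt (pmf \<sigma> w) * z w) (balanced m p n) = sqrt (design_mean m p n \<sigma> (\<lambda>w. (z w)\<^sup>2))"
    for z :: "(nat \<Rightarrow> nat) \<Rightarrow> real"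
    by (simp add: L2_set_def power_mult_distrib)
  have "sqrt (design_mean m p n \<sigma> (\<lambda>w. (u w - v w)\<^sup>2))
      = L2_set (\<lambda>w. sqrt (pmf \<sigma> w) * u w + sqrt (pmf \<sigma> w) * (- v w)) (balanced m p n)"
    by (simp add: L2[symmetric] algebra_simps)
  also have "\<dots> \<le> L2_set (\<lambda>w. sqrt (pmf \<sigma> w) * u w) (balanced m p n)
      + L2_set (\<lambda>w. sqrt (pmf \<sigma> w) * (- v w)) (balanced m p n)"
    by (rule L2_set_triangle_ineq)
  also have "\<dots> \<le> a + b"
    using assms unfolding L2 by (simp add: add_mono)
  finally have "sqrt (design_mean m p n \<sigma> (\<lambda>w. (u w - v w)\<^sup>2)) \<le> a + b" .
  then show ?thesis by (rule sqrt_le_D)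
qed

section \<open>Imbalance under the optimal designs\<close>

text \<open>
  The common property of the two optimal designs from which the variance bound follows; the level \<open>B\<close>
  will be the optimal value of the respective criterion.
\<close>

definition controls_imbalance :: "('x \<Rightarrow> real) set \<Rightarrow> (('x \<Rightarrow> real) \<Rightarrow> real) \<Rightarrow> nat \<Rightarrow> nat \<Rightarrow> nat \<Rightarrow>
    (nat \<Rightarrow> 'x) \<Rightarrow> (nat \<Rightarrow> nat) pmf \<Rightarrow> ennreal \<Rightarrow> bool" where
  "controls_imbalance F nrm m p n x \<sigma> B \<longleftrightarrow>
     \<sigma> \<in> mixed_strategies m p n \<and>
     (\<forall>h k l. qnorm F nrm h \<le> 1 \<longrightarrow> k \<in> {1..m} \<longrightarrow> l \<in> {1..m} \<longrightarrow> k \<noteq> l \<longrightarrow>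
        ennreal (design_mean m p n \<sigma> (\<lambda>w. (imbalance p n x k l w h)\<^sup>2)) \<le> B)"

text \<open>
  For \<open>r > 0\<close> this is homogeneity. For \<open>r = 0\<close> the bound is zero even if \<open>B\<close> is infinite, as
  \<open>0 * \<infinity> = 0\<close>: then \<open>g\<close> takes one value on the sample, and groups of equal size have no imbalance.
\<close>

lemma controls_imbalance_scaled:
  assumes F: "normed_function_space F nrm"
    and eval: "\<And>i j. i \<in> {1..n} \<Longrightarrow> j \<in> {1..n} \<Longrightarrow> eval_diff_continuous F nrm (x i) (x j)"
    and \<sigma>: "controls_imbalance F nrm m p n x \<sigma> B"
    and g: "qnorm F nrm g = ennreal r" "r \<ge> 0"
    and kl: "k \<in> {1..m}" "l \<in> {1..m}" "k \<noteq> l"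
  shows "ennreal (design_mean m p n \<sigma> (\<lambda>w. (imbalance p n x k l w g)\<^sup>2)) \<le> ennreal (r\<^sup>2) * B"
proof (cases "r = 0")
  case True
  have "imbalance p n x k l w g = 0" if w: "w \<in> balanced m p n" for w
  proof -
    have "group_mean p n x w g j = 1 / real p * (\<Sum>i | i \<in> {1..n} \<and> w i = j. g (x 1))" for j
      unfolding group_mean_def using qnorm_eq_0_imp_equal_values[OF F eval] g True
      by (intro arg_cong2[of _ _ _ _ "(*)"] sum.cong refl) auto
    then show ?thesis
      using balancedD(2)[OF w kl(1)] balancedD(2)[OF w kl(2)] by (simp add: imbalance_eq_group_means)
  qed
  then show ?thesis by simp
next
  case False
  then have r: "r > 0" using g by simp
  have "qnorm F nrm (\<lambda>z. 1 / r * g z) \<le> ennreal (1 / r) * ennreal r"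
    using qnorm_cmult_le[OF F, of "1 / r" g] r g by simp
  also have "\<dots> = 1" using r by (simp add: ennreal_mult[symmetric])
  finally have "ennreal (design_mean m p n \<sigma> (\<lambda>w. (imbalance p n x k l w (\<lambda>z. 1 / r * g z))\<^sup>2)) \<le> B"
    using \<sigma> kl unfolding controls_imbalance_def by blast
  moreover have "imbalance p n x k l w (\<lambda>z. 1 / r * g z) = 1 / r * imbalance p n x k l w g" for w
    by (simp add: imbalance_def sum_divide_distrib[symmetric] right_diff_distrib mult_ac)
  then have "r\<^sup>2 * design_mean m p n \<sigma> (\<lambda>w. (imbalance p n x k l w (\<lambda>z. 1 / r * g z))\<^sup>2)
      = design_mean m p n \<sigma> (\<lambda>w. (imbalance p n x k l w g)\<^sup>2)"
    using r by (simp add: power_mult_distrib power_divide sum_distrib_left)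
  then have "ennreal (design_mean m p n \<sigma> (\<lambda>w. (imbalance p n x k l w g)\<^sup>2)) = ennreal (r\<^sup>2) *
      ennreal (design_mean m p n \<sigma> (\<lambda>w. (imbalance p n x k l w (\<lambda>z. 1 / r * g z))\<^sup>2))"
    by (simp add: ennreal_mult'[symmetric])
  ultimately show ?thesis
    by (simp only:) (rule mult_left_mono, simp_all)
qed

text \<open>
  The imbalance part of the conditional variance. The two deviations need not be uncorrelated, hence
  the square of the sum of the norms.
\<close>

lemma group_deviation_difference_le:
  assumes pn: "p \<ge> 1" "n = m * p" and F: "normed_function_space F nrm"
    and eval: "\<And>i j. i \<in> {1..n} \<Longrightarrow> j \<in> {1..n} \<Longrightarrow> eval_diff_continuous F nrm (x i) (x j)"
    and \<sigma>: "controls_imbalance F nrm m p n x \<sigma> B"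
    and g: "qnorm F nrm g = ennreal r" "r \<ge> 0" and g': "qnorm F nrm g' = ennreal r'" "r' \<ge> 0"
    and k: "k \<in> {1..m}" "k' \<in> {1..m}" "k \<noteq> k'"
  shows "ennreal (design_mean m p n \<sigma> (\<lambda>w. (group_deviation p n x w g k - group_deviation p n x w g' k')\<^sup>2))
    \<le> ennreal ((r + r')\<^sup>2 / 2 * (1 - 1 / real m)) * B"
proof -
  define c where "c = (1 - 1 / real m) / 2"
  have "m \<ge> 2" using k by (cases "k < k'") auto
  then have c: "c > 0" unfolding c_def by (simp add: field_simps)
  have \<sigma>': "\<sigma> \<in> mixed_strategies m p n" using \<sigma> by (simp add: controls_imbalance_def)
  let ?V = "design_mean m p n \<sigma> (\<lambda>w. (group_deviation p n x w g k - group_deviation p n x w g' k')\<^sup>2)"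
  \<comment> \<open>The argument with real numbers, for any real level \<open>b\<close> that serves the norms \<open>r\<close> and \<open>r'\<close>.\<close>
  have finite_case: ?thesis if B: "\<And>s h j l. s \<in> {r, r'} \<Longrightarrow> qnorm F nrm h = ennreal s \<Longrightarrow>
      j \<in> {1..m} \<Longrightarrow> l \<in> {1..m} \<Longrightarrow> j \<noteq> l \<Longrightarrow>
      design_mean m p n \<sigma> (\<lambda>w. (imbalance p n x j l w h)\<^sup>2) \<le> s\<^sup>2 * b"
    and b: "b \<ge> 0" "ennreal ((r + r')\<^sup>2 * c * b) \<le> ennreal ((r + r')\<^sup>2 * c) * B" for b
  proof -
    have dev: "sqrt (design_mean m p n \<sigma> (\<lambda>w. (group_deviation p n x w h j)\<^sup>2)) \<le> s * sqrt (c * b)"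
      if "s \<in> {r, r'}" "qnorm F nrm h = ennreal s" "j \<in> {1..m}" for s h j
    proof -
      have "design_mean m p n \<sigma> (\<lambda>w. (group_deviation p n x w h j)\<^sup>2) \<le> c * (s\<^sup>2 * b)"
        unfolding c_def by (rule design_variance_group_deviation_le[OF pn \<sigma>' that(3) B[OF that(1,2)]])
      then have "sqrt (design_mean m p n \<sigma> (\<lambda>w. (group_deviation p n x w h j)\<^sup>2)) \<le> sqrt (s\<^sup>2 * (c * b))"
        by (intro real_sqrt_le_mono) (simp add: mult_ac)
      also have "\<dots> = s * sqrt (c * b)"
        using that g g' by (auto simp: real_sqrt_mult)
      finally show ?thesis .
    qed
    have "?V \<le> (r * sqrt (c * b) + r' * sqrt (c * b))\<^sup>2"
      using g g' k by (intro design_minkowski dev) auto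
    also have "\<dots> = (r + r')\<^sup>2 * c * b"
      using b c by (simp add: distrib_right[symmetric] power_mult_distrib)
    finally have "ennreal ?V \<le> ennreal ((r + r')\<^sup>2 * c * b)" by (rule ennreal_leI)
    also note b(2)
    finally show ?thesis by (simp add: c_def)
  qed
  have scaled: "ennreal (design_mean m p n \<sigma> (\<lambda>w. (imbalance p n x j l w h)\<^sup>2)) \<le> ennreal (s\<^sup>2) * B"
    if "s \<in> {r, r'}" "qnorm F nrm h = ennreal s" "j \<in> {1..m}" "l \<in> {1..m}" "j \<noteq> l" for s h j l
    using controls_imbalance_scaled[OF F eval \<sigma> that(2) _ that(3-5)] that(1) g g' by auto
  show ?thesis
  proof (cases B)
    case (real b)
    show ?thesis
    proof (rule finite_case[OF _ real(1)])
      fix s h j l assume *: "s \<in> {r, r'}" "qnorm F nrm h = ennreal s" "j \<in> {1..m}" "l \<in> {1..m}" "j \<noteq> l"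
      have "ennreal (design_mean m p n \<sigma> (\<lambda>w. (imbalance p n x j l w h)\<^sup>2)) \<le> ennreal (s\<^sup>2 * b)"
        using scaled[OF *] real by (simp add: ennreal_mult)
      then show "design_mean m p n \<sigma> (\<lambda>w. (imbalance p n x j l w h)\<^sup>2) \<le> s\<^sup>2 * b"
        using real by (simp add: ennreal_le_iff)
    qed (use real c in \<open>simp add: ennreal_mult\<close>)
  next
    case top
    show ?thesis
    proof (cases "r + r' = 0")
      case True
      then have 0: "r = 0" "r' = 0" using g g' by linarith+
      show ?thesis
      \<comment> \<open>Both norms vanish, so the level \<open>0\<close> serves although \<open>B\<close> is infinite.\<close>
      proof (rule finite_case[of 0])
        fix s h j l assume *: "s \<in> {r, r'}" "qnorm F nrm h = ennreal s" "j \<in> {1..m}" "l \<in> {1..m}" "j \<noteq> l"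
        have "ennreal (design_mean m p n \<sigma> (\<lambda>w. (imbalance p n x j l w h)\<^sup>2)) \<le> 0"
          using scaled[OF *] *(1) 0 by simp
        then show "design_mean m p n \<sigma> (\<lambda>w. (imbalance p n x j l w h)\<^sup>2) \<le> s\<^sup>2 * 0"
          by (simp add: ennreal_eq_0_iff)
      qed auto
    next
      case False
      then have "(r + r')\<^sup>2 / 2 * (1 - 1 / real m) > 0"
        using c unfolding c_def by (simp add: zero_less_mult_iff)
      then have "ennreal ((r + r')\<^sup>2 / 2 * (1 - 1 / real m)) \<noteq> 0"
        by (simp only: ennreal_eq_0_iff not_le)
      then have "ennreal ((r + r')\<^sup>2 / 2 * (1 - 1 / real m)) * B = top"
        using top by (simp only: ennreal_mult_eq_top_iff) simp
      then show ?thesis by (simp only: top_greatest)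
    qed
  qed
qed

lemma MSOD_controls_imbalance:
  assumes "\<sigma> \<in> MSODs F nrm m p n x"
  shows "controls_imbalance F nrm m p n x \<sigma> (MM2_opt F nrm m p n x)"
proof -
  have \<sigma>: "\<sigma> \<in> mixed_strategies m p n"
    and opt: "MM2 F nrm m p n x \<sigma> \<le> MM2_opt F nrm m p n x"
    using assms by (auto simp: MSODs_def MM2_opt_def intro!: INF_greatest)
  have "ennreal (design_mean m p n \<sigma> (\<lambda>w. (imbalance p n x k l w h)\<^sup>2)) \<le> MM2 F nrm m p n x \<sigma>"
    if "qnorm F nrm h \<le> 1" "k \<in> {1..m}" "l \<in> {1..m}" "k \<noteq> l" for h k l
    unfolding MM2_def using that
    by (intro SUP_upper2[of h] SUP_upper2[of "(k, l)"]) (auto simp: treatment_pairs_def)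
  then show ?thesis
    using \<sigma> opt by (auto simp: controls_imbalance_def intro: order_trans)
qed

lemma MP2_relabel_le:
  assumes \<pi>: "\<pi> permutes {1..m}"
  shows "MP2 F nrm m p n x (relabel n \<pi> w) \<le> MP2 F nrm m p n x w"
  unfolding MP2_def
proof (intro SUP_least)
  fix h kl assume h: "h \<in> {g. qnorm F nrm g \<le> 1}" and kl: "kl \<in> treatment_pairs m"
  obtain k l where kl_eq: "kl = (k, l)" by (cases kl)
  let ?k = "inv \<pi> k" and ?l = "inv \<pi> l"
  have pair: "(?k, ?l) \<in> treatment_pairs m"
    using kl kl_eq permutes_in_image[OF permutes_inv[OF \<pi>]] injD[OF permutes_inj[OF permutes_inv[OF \<pi>]]]
    by (auto simp: treatment_pairs_def)
  have "imbalance p n x k l (relabel n \<pi> w) h = imbalance p n x ?k ?l w h"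
    using group_mean_relabel[OF \<pi>, of p n x w h ?k] group_mean_relabel[OF \<pi>, of p n x w h ?l]
    by (simp add: imbalance_eq_group_means permutes_inverses(1)[OF \<pi>])
  then show "(case kl of (k, l) \<Rightarrow> ennreal ((imbalance p n x k l (relabel n \<pi> w) h)\<^sup>2))
      \<le> (SUP g\<in>{g. qnorm F nrm g \<le> 1}. SUP (k, l)\<in>treatment_pairs m. ennreal ((imbalance p n x k l w g)\<^sup>2))"
    using h pair kl_eq by (intro SUP_upper2[of h] SUP_upper2[of "(?k, ?l)"]) auto
qed

text \<open>
  The criterion is a maximum over all ordered pairs of treatments, and a relabelling permutes these pairs.
\<close>

lemma MP2_relabel:
  assumes \<pi>: "\<pi> permutes {1..m}" and w: "w \<in> balanced m p n"
  shows "MP2 F nrm m p n x (relabel n \<pi> w) = MP2 F nrm m p n x w"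
  using MP2_relabel_le[OF \<pi>, of F nrm p n x w]
    MP2_relabel_le[OF permutes_inv[OF \<pi>], of F nrm p n x "relabel n \<pi> w"]
  by (simp add: relabel_inv[OF \<pi> w])

text \<open>
  Invariance of the criterion makes the set of minimisers invariant, so the uniform law on it is
  symmetric. On the unit ball the squared imbalances of each minimiser are at most the optimal value, hence
  so is their average.
\<close>

lemma PSOD_controls_imbalance:
  assumes pn: "p \<ge> 1" "n = m * p"
  shows "controls_imbalance F nrm m p n x (PSOD F nrm m p n x) (MP2_opt F nrm m p n x)"
proof -
  define A where "A = {w \<in> balanced m p n. \<forall>w' \<in> balanced m p n. MP2 F nrm m p n x w \<le> MP2 F nrm m p n x w'}"
  have A: "A \<subseteq> balanced m p n" "finite A"
    using finite_balanced by (auto simp: A_def)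
  have "A \<noteq> {}"
    using arg_min_if_finite[OF finite_balanced balanced_nonempty[OF pn], of "MP2 F nrm m p n x"]
    unfolding A_def by (auto simp: not_less)
  note pmf_A = pmf_of_set[OF this A(2)] and set_A = set_pmf_of_set[OF this A(2)]
  have PSOD: "PSOD F nrm m p n x = pmf_of_set A" by (simp add: PSOD_def A_def)
  have "pmf (pmf_of_set A) w = pmf (pmf_of_set A) (relabel n \<pi> w)"
    if \<pi>: "\<pi> permutes {1..m}" and w: "w \<in> balanced m p n" for \<pi> w
  proof -
    have "relabel n \<pi> w \<in> A \<longleftrightarrow> w \<in> A"
      unfolding A_def using MP2_relabel[OF \<pi> w, of F nrm x] relabel_balanced[OF \<pi> w] w by auto
    then show ?thesis by (simp add: pmf_A indicator_def)
  qed
  then have \<sigma>: "pmf_of_set A \<in> mixed_strategies m p n"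
    using A(1) set_A by (auto simp: mixed_strategies_def relabel_def)
  have "ennreal (design_mean m p n (pmf_of_set A) (\<lambda>w. (imbalance p n x k l w h)\<^sup>2)) \<le> MP2_opt F nrm m p n x"
    if h: "qnorm F nrm h \<le> 1" and kl: "k \<in> {1..m}" "l \<in> {1..m}" "k \<noteq> l" for h k l
  proof -
    have opt: "ennreal ((imbalance p n x k l w h)\<^sup>2) \<le> MP2_opt F nrm m p n x" if "w \<in> A" for w
    proof -
      have "ennreal ((imbalance p n x k l w h)\<^sup>2) \<le> MP2 F nrm m p n x w"
        unfolding MP2_def using h kl
        by (intro SUP_upper2[of h] SUP_upper2[of "(k, l)"]) (auto simp: treatment_pairs_def)
      also have "\<dots> \<le> MP2_opt F nrm m p n x"
        using that unfolding MP2_opt_def A_def by (intro INF_greatest) auto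
      finally show ?thesis .
    qed
    have "ennreal (design_mean m p n (pmf_of_set A) (\<lambda>w. (imbalance p n x k l w h)\<^sup>2))
        = (\<Sum>w\<in>balanced m p n. ennreal (pmf (pmf_of_set A) w) * ennreal ((imbalance p n x k l w h)\<^sup>2))"
      by (simp add: sum_ennreal[symmetric] ennreal_mult)
    also have "\<dots> \<le> (\<Sum>w\<in>balanced m p n. ennreal (pmf (pmf_of_set A) w) * MP2_opt F nrm m p n x)"
    proof (rule sum_mono)
      fix w assume "w \<in> balanced m p n"
      show "ennreal (pmf (pmf_of_set A) w) * ennreal ((imbalance p n x k l w h)\<^sup>2)
          \<le> ennreal (pmf (pmf_of_set A) w) * MP2_opt F nrm m p n x"
        using opt by (cases "w \<in> A") (auto simp: pmf_A intro: mult_left_mono)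
    qed
    also have "\<dots> = ennreal (\<Sum>w\<in>balanced m p n. pmf (pmf_of_set A) w) * MP2_opt F nrm m p n x"
      by (simp add: sum_distrib_right[symmetric] sum_ennreal)
    finally show ?thesis by (simp add: pmf_design_sum[OF \<sigma>])
  qed
  then show ?thesis using \<sigma> by (auto simp: controls_imbalance_def PSOD)
qed

section \<open>Square-integrable functions and sub-sigma-algebras\<close>

definition square_integrable :: "'a measure \<Rightarrow> ('a \<Rightarrow> real) \<Rightarrow> bool" where
  "square_integrable M u \<longleftrightarrow> u \<in> borel_measurable M \<and> integrable M (\<lambda>\<omega>. (u \<omega>)\<^sup>2)"

lemma square_integrable_mult:
  assumes "square_integrable M u" "square_integrable M v"
  shows "integrable M (\<lambda>\<omega>. u \<omega> * v \<omega>)"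
proof (rule Bochner_Integration.integrable_bound[of M "\<lambda>\<omega>. (u \<omega>)\<^sup>2 + (v \<omega>)\<^sup>2"])
  show "AE \<omega> in M. norm (u \<omega> * v \<omega>) \<le> norm ((u \<omega>)\<^sup>2 + (v \<omega>)\<^sup>2)"
  proof (rule AE_I2)
    fix \<omega>
    have "2 * (\<bar>u \<omega>\<bar> * \<bar>v \<omega>\<bar>) \<le> (u \<omega>)\<^sup>2 + (v \<omega>)\<^sup>2"
      using sum_squares_bound[of "\<bar>u \<omega>\<bar>" "\<bar>v \<omega>\<bar>"] by simp
    moreover have "0 \<le> \<bar>u \<omega>\<bar> * \<bar>v \<omega>\<bar>" by simp
    ultimately show "norm (u \<omega> * v \<omega>) \<le> norm ((u \<omega>)\<^sup>2 + (v \<omega>)\<^sup>2)"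
      unfolding real_norm_def abs_mult by linarith
  qed
qed (use assms in \<open>auto simp: square_integrable_def\<close>)

lemma square_integrable_add:
  assumes "square_integrable M u" "square_integrable M v"
  shows "square_integrable M (\<lambda>\<omega>. u \<omega> + v \<omega>)"
proof -
  have "integrable M (\<lambda>\<omega>. (u \<omega>)\<^sup>2 + (v \<omega>)\<^sup>2 + 2 * (u \<omega> * v \<omega>))"
    using assms square_integrable_mult[OF assms] by (auto simp: square_integrable_def)
  then show ?thesis
    using assms by (auto simp: square_integrable_def power2_sum mult.assoc)
qed

lemma square_integrable_cmult:
  "square_integrable M u \<Longrightarrow> square_integrable M (\<lambda>\<omega>. c * u \<omega>)"
  by (auto simp: square_integrable_def power_mult_distrib)

lemma square_integrable_diff:
  "square_integrable M u \<Longrightarrow> square_integrable M v \<Longrightarrow> square_integrable M (\<lambda>\<omega>. u \<omega> - v \<omega>)"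
  using square_integrable_add[OF _ square_integrable_cmult[of M v "-1"]] by simp

lemma square_integrable_zero: "square_integrable M (\<lambda>\<omega>. 0)"
  by (simp add: square_integrable_def)

lemma square_integrable_sum:
  "(\<And>i. i \<in> I \<Longrightarrow> square_integrable M (u i)) \<Longrightarrow> square_integrable M (\<lambda>\<omega>. \<Sum>i\<in>I. u i \<omega>)"
  by (induction I rule: infinite_finite_induct) (auto intro: square_integrable_zero square_integrable_add)

lemma (in finite_measure) square_integrable_const: "square_integrable M (\<lambda>\<omega>. c)"
  by (simp add: square_integrable_def)

lemma (in finite_measure) square_integrable_integrable:
  "square_integrable M u \<Longrightarrow> integrable M u"
  unfolding square_integrable_def using square_integrable_imp_integrable by blast

lemma integrable_bounded_mult:
  fixes u v :: "'a \<Rightarrow> real"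
  assumes "u \<in> borel_measurable M" "AE \<omega> in M. \<bar>u \<omega>\<bar> \<le> 1" "integrable M v"
  shows "integrable M (\<lambda>\<omega>. u \<omega> * v \<omega>)"
proof (rule Bochner_Integration.integrable_bound[OF assms(3)])
  show "AE \<omega> in M. norm (u \<omega> * v \<omega>) \<le> norm (v \<omega>)"
    using assms(2) by eventually_elim (simp add: abs_mult mult_left_le_one_le)
qed (use assms in auto)

lemma square_integrable_bounded_mult:
  assumes "u \<in> borel_measurable M" "AE \<omega> in M. \<bar>u \<omega>\<bar> \<le> 1" "square_integrable M v"
  shows "square_integrable M (\<lambda>\<omega>. u \<omega> * v \<omega>)"
proof -
  have "integrable M (\<lambda>\<omega>. (u \<omega>)\<^sup>2 * (v \<omega>)\<^sup>2)"
  proof (rule integrable_bounded_mult)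
    show "AE \<omega> in M. \<bar>(u \<omega>)\<^sup>2\<bar> \<le> 1"
      using assms(2) by eventually_elim (simp add: abs_square_le_1)
  qed (use assms in \<open>auto simp: square_integrable_def\<close>)
  then show ?thesis
    using assms by (auto simp: square_integrable_def power_mult_distrib)
qed

lemma subalgebra_generated:
  assumes "V \<in> measurable M S"
  shows "subalgebra M (generated M V S)"
  unfolding subalgebra_def generated_def
  using assms by (auto simp: sets_vimage_algebra2 measurable_space)

lemma measurable_generated:
  assumes "V \<in> measurable M S"
  shows "V \<in> measurable (generated M V S) S"
  unfolding generated_def using assms by (intro measurable_vimage_algebra1) (auto dest: measurable_space)

lemma borel_measurable_generated_trans:
  assumes u: "u \<in> borel_measurable (generated M V S)"
    and V: "V \<in> measurable K S" and K: "space K = space M"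
  shows "u \<in> borel_measurable K"
proof -
  have "(\<lambda>\<omega>. \<omega>) \<in> measurable K (generated M V S)"
    unfolding generated_def using V K by (intro measurable_vimage_algebra2) auto
  from measurable_compose[OF this u] show ?thesis by simp
qed

text \<open>
  If \<open>u\<close> and \<open>v\<close> have the same integrals over the sets of \<open>H\<close>, their conditional expectations given \<open>H\<close>
  agree. This passes from events to integrands twice: for the independence of assignment and outcomes,
  and for the orthogonality of the residuals.
\<close>

lemma (in prob_space) integral_mult_eq_on_subalgebra:
  assumes sub: "subalgebra M H" and Z: "Z \<in> borel_measurable H"
    and uv: "integrable M u" "integrable M v"
    and Zuv: "integrable M (\<lambda>\<omega>. Z \<omega> * u \<omega>)" "integrable M (\<lambda>\<omega>. Z \<omega> * v \<omega>)"
    and eq: "\<And>A. A \<in> sets H \<Longrightarrow> (\<integral>\<omega>. indicator A \<omega> * u \<omega> \<partial>M) = (\<integral>\<omega>. indicator A \<omega> * v \<omega> \<partial>M)"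
  shows "(\<integral>\<omega>. Z \<omega> * u \<omega> \<partial>M) = (\<integral>\<omega>. Z \<omega> * (v \<omega> :: real) \<partial>M)"
proof -
  interpret H: finite_measure_subalgebra M H by unfold_locales (rule sub)
  have "AE \<omega> in M. real_cond_exp M H u \<omega> = real_cond_exp M H v \<omega>"
  proof (rule H.real_cond_exp_charact)
    fix A assume A: "A \<in> sets H"
    have "(\<integral>\<omega>\<in>A. u \<omega> \<partial>M) = (\<integral>\<omega>\<in>A. v \<omega> \<partial>M)"
      using eq[OF A] by (simp add: set_lebesgue_integral_def)
    then show "(\<integral>\<omega>\<in>A. u \<omega> \<partial>M) = (\<integral>\<omega>\<in>A. real_cond_exp M H v \<omega> \<partial>M)"
      using H.real_cond_exp_intA[OF uv(2) A] by simp
  qed (use uv H.real_cond_exp_int in auto)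
  moreover have ZM: "Z \<in> borel_measurable M"
    by (rule measurable_from_subalg[OF sub Z])
  ultimately have "(\<integral>\<omega>. Z \<omega> * real_cond_exp M H u \<omega> \<partial>M) = (\<integral>\<omega>. Z \<omega> * real_cond_exp M H v \<omega> \<partial>M)"
    by (intro integral_cong_AE) auto
  then show ?thesis
    using H.real_cond_exp_intg(2)[OF Zuv(1) Z] H.real_cond_exp_intg(2)[OF Zuv(2) Z] uv by simp
qed

section \<open>Independent subjects\<close>

locale iid_sample = prob_space M for M :: "'a measure" +
  fixes N :: "'x measure" and m n :: nat
    and X :: "nat \<Rightarrow> 'a \<Rightarrow> 'x" and Y :: "nat \<Rightarrow> nat \<Rightarrow> 'a \<Rightarrow> real" and f :: "nat \<Rightarrow> 'x \<Rightarrow> real"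
  assumes iid: "iid_subjects M N m n X Y"
    and outcome_square_integrable: "\<And>i k. i \<in> {1..n} \<Longrightarrow> k \<in> {1..m} \<Longrightarrow> integrable M (\<lambda>\<omega>. (Y i k \<omega>)\<^sup>2)"
    and regression: "\<And>i k. i \<in> {1..n} \<Longrightarrow> k \<in> {1..m} \<Longrightarrow> regression_function M N (Y i k) (X i) (f k)"
    and n_pos: "n \<ge> 1"
begin

abbreviation record_space :: "('x \<times> (nat \<Rightarrow> real)) measure" where
  "record_space \<equiv> N \<Otimes>\<^sub>M outcome_space m"

abbreviation record_of :: "nat \<Rightarrow> 'a \<Rightarrow> 'x \<times> (nat \<Rightarrow> real)" where
  "record_of i \<omega> \<equiv> (X i \<omega>, outcomes m Y i \<omega>)"

abbreviation eps :: "nat \<Rightarrow> nat \<Rightarrow> 'a \<Rightarrow> real" where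
  "eps \<equiv> residual X Y f"

lemma records_indep: "indep_vars (\<lambda>_. record_space) record_of {1..n}"
  using iid by (simp add: iid_subjects_def)

lemma record_measurable:
  assumes "i \<in> {1..n}"
  shows "record_of i \<in> measurable M record_space"
  using records_indep assms unfolding indep_vars_def2 by blast

lemma X_measurable: "i \<in> {1..n} \<Longrightarrow> X i \<in> measurable M N"
  using measurable_compose[OF record_measurable measurable_fst] by simp

lemma outcome_coord_measurable: "k \<in> {1..m} \<Longrightarrow> (\<lambda>y. y k) \<in> borel_measurable (outcome_space m)"
  unfolding outcome_space_def by (rule measurable_component_singleton)

lemma outcomes_measurable: "i \<in> {1..n} \<Longrightarrow> outcomes m Y i \<in> measurable M (outcome_space m)"
  using measurable_compose[OF record_measurable measurable_snd] by simp

lemma outcome_measurable: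
  assumes "i \<in> {1..n}" "k \<in> {1..m}"
  shows "Y i k \<in> borel_measurable M"
  using measurable_compose[OF outcomes_measurable[OF assms(1)] outcome_coord_measurable[OF assms(2)]] assms(2)
  by (simp add: outcomes_def)

lemma f_measurable: "k \<in> {1..m} \<Longrightarrow> f k \<in> borel_measurable N"
  using regression[of 1 k] n_pos by (simp add: regression_function_def)

lemma covariates_measurable: "covariates n X \<in> measurable M (PiM {1..n} (\<lambda>_. N))"
  unfolding covariates_def by (rule measurable_restrict) (rule X_measurable)

lemma all_outcomes_measurable:
  "all_outcomes m n Y \<in> measurable M (PiM {1..n} (\<lambda>_. outcome_space m))"
  unfolding all_outcomes_def by (rule measurable_restrict) (rule outcomes_measurable)

lemma Y_square_integrable: "i \<in> {1..n} \<Longrightarrow> k \<in> {1..m} \<Longrightarrow> square_integrable M (Y i k)"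
  using outcome_square_integrable outcome_measurable by (simp add: square_integrable_def)

lemma cond_exp_outcome:
  assumes "i \<in> {1..n}" "k \<in> {1..m}"
  shows "AE \<omega> in M. real_cond_exp M (generated M (X i) N) (Y i k) \<omega> = f k (X i \<omega>)"
  using regression[OF assms] by (simp add: regression_function_def)

text \<open>
  Jensen's inequality for conditional expectations.
\<close>

lemma f_square_integrable:
  assumes i: "i \<in> {1..n}" and k: "k \<in> {1..m}"
  shows "square_integrable M (\<lambda>\<omega>. f k (X i \<omega>))"
proof -
  interpret G: finite_measure_subalgebra M "generated M (X i) N"
    by unfold_locales (rule subalgebra_generated[OF X_measurable[OF i]])
  have fX: "(\<lambda>\<omega>. f k (X i \<omega>)) \<in> borel_measurable M"
    by (rule measurable_compose[OF X_measurable[OF i] f_measurable[OF k]])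
  have "integrable M (\<lambda>\<omega>. (real_cond_exp M (generated M (X i) N) (Y i k) \<omega>)\<^sup>2)"
  proof (rule G.integrable_convex_cond_exp[where I = UNIV])
    show "integrable M (Y i k)"
      using Y_square_integrable[OF i k] by (rule square_integrable_integrable)
    show "convex_on UNIV (\<lambda>x::real. x\<^sup>2)" by (rule convex_power2)
  qed (use outcome_square_integrable[OF i k] in auto)
  moreover have "integrable M (\<lambda>\<omega>. (real_cond_exp M (generated M (X i) N) (Y i k) \<omega>)\<^sup>2)
      \<longleftrightarrow> integrable M (\<lambda>\<omega>. (f k (X i \<omega>))\<^sup>2)"
  proof (rule integrable_cong_AE)
    show "AE \<omega> in M. (real_cond_exp M (generated M (X i) N) (Y i k) \<omega>)\<^sup>2 = (f k (X i \<omega>))\<^sup>2"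
      using cond_exp_outcome[OF i k] by eventually_elim simp
  qed (use fX in auto)
  ultimately show ?thesis using fX by (simp add: square_integrable_def)
qed

lemma eps_square_integrable:
  "i \<in> {1..n} \<Longrightarrow> k \<in> {1..m} \<Longrightarrow> square_integrable M (eps i k)"
  unfolding residual_def by (intro square_integrable_diff Y_square_integrable f_square_integrable)

lemma eps_integrable: "i \<in> {1..n} \<Longrightarrow> k \<in> {1..m} \<Longrightarrow> integrable M (eps i k)"
  by (rule square_integrable_integrable[OF eps_square_integrable])

lemma integral_record_eq:
  assumes i: "i \<in> {1..n}" and \<phi>: "\<phi> \<in> borel_measurable record_space"
  shows "(\<integral>\<omega>. \<phi> (record_of i \<omega>) \<partial>M) = (\<integral>\<omega>. (\<phi> (record_of 1 \<omega>) :: real) \<partial>M)"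
proof -
  have 1: "1 \<in> {1..n}" using n_pos by simp
  have "(\<integral>\<omega>. \<phi> (record_of i \<omega>) \<partial>M) = integral\<^sup>L (distr M record_space (record_of i)) \<phi>"
    by (rule integral_distr[OF record_measurable[OF i] \<phi>, symmetric])
  also have "distr M record_space (record_of i) = distr M record_space (record_of 1)"
    using iid i 1 unfolding iid_subjects_def by blast
  also have "integral\<^sup>L (distr M record_space (record_of 1)) \<phi> = (\<integral>\<omega>. \<phi> (record_of 1 \<omega>) \<partial>M)"
    by (rule integral_distr[OF record_measurable[OF 1] \<phi>])
  finally show ?thesis .
qed

lemma eps_record: "k \<in> {1..m} \<Longrightarrow> eps i k \<omega> = (\<lambda>(x, y). y k - f k x) (record_of i \<omega>)"
  by (simp add: residual_def outcomes_def)

lemma eps_record_measurable: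
  assumes "k \<in> {1..m}"
  shows "(\<lambda>(x, y). y k - f k x) \<in> borel_measurable record_space"
  unfolding split_beta'
  by (intro borel_measurable_diff measurable_compose[OF measurable_snd outcome_coord_measurable[OF assms]]
      measurable_compose[OF measurable_fst f_measurable[OF assms]])

lemma eps_second_moment_eq:
  assumes i: "i \<in> {1..n}" and k: "k \<in> {1..m}"
  shows "(\<integral>\<omega>. (eps i k \<omega>)\<^sup>2 \<partial>M) = (\<integral>\<omega>. (eps 1 k \<omega>)\<^sup>2 \<partial>M)"
  unfolding eps_record[OF k]
  by (rule integral_record_eq[OF i]) (intro borel_measurable_power eps_record_measurable[OF k])

text \<open>
  The residual has conditional mean zero given its own covariate, by the choice of \<open>f\<close>.
\<close>

lemma eps_orthogonal_own_covariate:
  assumes i: "i \<in> {1..n}" and k: "k \<in> {1..m}" and B: "B \<in> sets N"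
  shows "(\<integral>\<omega>. indicator B (X i \<omega>) * eps i k \<omega> \<partial>M) = 0"
proof -
  let ?G = "generated M (X i) N"
  interpret G: finite_measure_subalgebra M ?G
    by unfold_locales (rule subalgebra_generated[OF X_measurable[OF i]])
  have XG: "X i \<in> measurable ?G N" by (rule measurable_generated[OF X_measurable[OF i]])
  have ind: "(\<lambda>\<omega>. indicator B (X i \<omega>) :: real) \<in> borel_measurable ?G"
    by (rule measurable_compose[OF XG borel_measurable_indicator[OF B]])
  have fG: "(\<lambda>\<omega>. f k (X i \<omega>)) \<in> borel_measurable ?G"
    by (rule measurable_compose[OF XG f_measurable[OF k]])
  have int: "integrable M (Y i k)" "integrable M (\<lambda>\<omega>. f k (X i \<omega>))"
    by (intro square_integrable_integrable Y_square_integrable f_square_integrable i k)+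
  have "AE \<omega> in M. real_cond_exp M ?G (eps i k) \<omega> = 0"
    using G.real_cond_exp_diff[OF int] G.real_cond_exp_F_meas[OF int(2) fG] cond_exp_outcome[OF i k]
    unfolding residual_def by eventually_elim simp
  then have "AE \<omega> in M. indicator B (X i \<omega>) * real_cond_exp M ?G (eps i k) \<omega> = 0"
    by eventually_elim simp
  then have "(\<integral>\<omega>. indicator B (X i \<omega>) * real_cond_exp M ?G (eps i k) \<omega> \<partial>M) = 0"
    by (rule integral_eq_zero_AE)
  moreover have "integrable M (\<lambda>\<omega>. indicator B (X i \<omega>) * eps i k \<omega>)"
    using measurable_from_subalg[OF G.subalg ind] eps_integrable[OF i k]
    by (intro integrable_bounded_mult) (auto simp: indicator_def)
  ultimately show ?thesis
    using G.real_cond_exp_intg(2)[OF _ ind] eps_integrable[OF i k] by fastforce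
qed

text \<open>
  What is known when all covariates, and the outcomes of all subjects except \<open>i\<close>, are known.
\<close>

definition others :: "nat \<Rightarrow> 'a measure" where
  "others i = generated M (\<lambda>\<omega>. (\<lambda>j\<in>{1..n} - {i}. record_of j \<omega>, X i \<omega>))
     (PiM ({1..n} - {i}) (\<lambda>_. record_space) \<Otimes>\<^sub>M N)"

lemma others_map_measurable:
  assumes i: "i \<in> {1..n}"
  shows "(\<lambda>\<omega>. (\<lambda>j\<in>{1..n} - {i}. record_of j \<omega>, X i \<omega>))
    \<in> measurable M (PiM ({1..n} - {i}) (\<lambda>_. record_space) \<Otimes>\<^sub>M N)"
  by (intro measurable_Pair measurable_restrict record_measurable X_measurable i) auto

lemma subalgebra_others: "i \<in> {1..n} \<Longrightarrow> subalgebra M (others i)"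
  unfolding others_def by (rule subalgebra_generated[OF others_map_measurable])

lemma record_measurable_others:
  assumes i: "i \<in> {1..n}" and j: "j \<in> {1..n}" "j \<noteq> i"
  shows "record_of j \<in> measurable (others i) record_space"
proof -
  have "j \<in> {1..n} - {i}" using j by simp
  note coord = measurable_component_singleton[OF this, of "\<lambda>_. record_space"]
  show ?thesis
    using measurable_compose[OF measurable_compose[OF measurable_generated[OF others_map_measurable[OF i]]
      measurable_fst] coord] j
    unfolding others_def by simp
qed

lemma X_measurable_others:
  assumes i: "i \<in> {1..n}" and j: "j \<in> {1..n}"
  shows "X j \<in> measurable (others i) N"
proof (cases "j = i")
  case True
  then show ?thesis
    using measurable_compose[OF measurable_generated[OF others_map_measurable[OF i]] measurable_snd]
    unfolding others_def by simp
next
  case False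
  then show ?thesis
    using measurable_compose[OF record_measurable_others[OF i j] measurable_fst] by simp
qed

lemma f_measurable_others:
  "i \<in> {1..n} \<Longrightarrow> j \<in> {1..n} \<Longrightarrow> k \<in> {1..m} \<Longrightarrow> (\<lambda>\<omega>. f k (X j \<omega>)) \<in> borel_measurable (others i)"
  by (rule measurable_compose[OF X_measurable_others f_measurable])

lemma eps_measurable_others:
  assumes "i \<in> {1..n}" "j \<in> {1..n}" "j \<noteq> i" "k \<in> {1..m}"
  shows "eps j k \<in> borel_measurable (others i)"
proof -
  have "eps j k = (\<lambda>\<omega>. (\<lambda>(x, y). y k - f k x) (record_of j \<omega>))"
    by (rule ext) (rule eps_record[OF assms(4)])
  then show ?thesis
    using measurable_compose[OF record_measurable_others[OF assms(1-3)] eps_record_measurable[OF assms(4)]]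
    by (simp only:)
qed

lemma covariates_measurable_others:
  "i \<in> {1..n} \<Longrightarrow> covariates n X \<in> measurable (others i) (PiM {1..n} (\<lambda>_. N))"
  unfolding covariates_def by (intro measurable_restrict X_measurable_others)

text \<open>
  The record of subject \<open>i\<close> is independent of the other records. By Fubini's theorem the other records
  can be held fixed, and then the event restricts the covariate of \<open>i\<close> only.
\<close>

lemma eps_integral_over_others:
  assumes i: "i \<in> {1..n}" and k: "k \<in> {1..m}" and A: "A \<in> sets (others i)"
  shows "(\<integral>\<omega>. indicator A \<omega> * eps i k \<omega> \<partial>M) = 0"
proof -
  let ?J = "PiM ({1..n} - {i}) (\<lambda>_. record_space)"
  let ?V = "\<lambda>\<omega>. \<lambda>j\<in>{1..n} - {i}. record_of j \<omega>"
  let ?e = "\<lambda>(x, y). y k - f k x"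
  obtain B where B: "B \<in> sets (?J \<Otimes>\<^sub>M N)" and A_eq: "A = (\<lambda>\<omega>. (?V \<omega>, X i \<omega>)) -` B \<inter> space M"
    using A measurable_space[OF others_map_measurable[OF i]] unfolding others_def generated_def
    by (subst (asm) sets_vimage_algebra2) auto
  let ?S = "PiM {i} (\<lambda>_. record_space)"
  let ?Z = "\<lambda>\<omega>. \<lambda>j\<in>{i}. record_of j \<omega>"
  \<comment> \<open>\<open>indep_var\<close> takes both variables in one type, hence the singleton product in place of the record.\<close>
  have "indep_var ?J ?V ?S ?Z"
    by (rule indep_var_restrict[OF records_indep]) (use i in auto)
  note ind = this[unfolded indep_var_distribution_eq]
  define P where "P = distr M ?J ?V"
  define Q where "Q = distr M ?S ?Z"
  have joint: "P \<Otimes>\<^sub>M Q = distr M (?J \<Otimes>\<^sub>M ?S) (\<lambda>\<omega>. (?V \<omega>, ?Z \<omega>))"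
    using ind by (simp add: P_def Q_def)
  have VZ: "(\<lambda>\<omega>. (?V \<omega>, ?Z \<omega>)) \<in> measurable M (?J \<Otimes>\<^sub>M ?S)"
    using ind by (intro measurable_Pair) auto
  interpret P: prob_space P unfolding P_def by (rule prob_space_distr) (use ind in auto)
  interpret Q: prob_space Q unfolding Q_def by (rule prob_space_distr) (use ind in auto)
  interpret PQ: pair_sigma_finite P Q ..
  define h where "h = (\<lambda>(v, z). indicator B (v, fst (z i)) * ?e (z i) :: real)"
  have h: "h \<in> borel_measurable (?J \<Otimes>\<^sub>M ?S)"
  proof -
    have coord: "(\<lambda>vz. snd vz i) \<in> measurable (?J \<Otimes>\<^sub>M ?S) record_space"
      by measurable
    then have "(\<lambda>vz. (fst vz, fst (snd vz i))) \<in> measurable (?J \<Otimes>\<^sub>M ?S) (?J \<Otimes>\<^sub>M N)"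
      by measurable
    from measurable_compose[OF this borel_measurable_indicator[OF B]]
      measurable_compose[OF coord eps_record_measurable[OF k]]
    show ?thesis unfolding h_def split_beta' by (intro borel_measurable_times) (simp_all add: split_beta')
  qed
  have e_int: "integrable M (\<lambda>\<omega>. h (?V \<omega>, ?Z \<omega>))"
  proof -
    have "(\<lambda>\<omega>. indicator B (?V \<omega>, X i \<omega>) :: real) \<in> borel_measurable M"
      using measurable_compose[OF others_map_measurable[OF i] borel_measurable_indicator[OF B]] .
    then have "integrable M (\<lambda>\<omega>. indicator B (?V \<omega>, X i \<omega>) * eps i k \<omega>)"
      by (intro integrable_bounded_mult eps_integrable i k) (auto simp: indicator_def)
    then show ?thesis unfolding h_def eps_record[OF k] by simp
  qed
  have "(\<integral>\<omega>. indicator A \<omega> * eps i k \<omega> \<partial>M) = (\<integral>\<omega>. h (?V \<omega>, ?Z \<omega>) \<partial>M)"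
    unfolding h_def eps_record[OF k] A_eq
    by (intro Bochner_Integration.integral_cong) (auto simp: indicator_def)
  also have "\<dots> = integral\<^sup>L (P \<Otimes>\<^sub>M Q) h"
    unfolding joint by (rule integral_distr[OF VZ h, symmetric])
  also have "\<dots> = (\<integral>v. (\<integral>z. h (v, z) \<partial>Q) \<partial>P)"
    by (rule PQ.integral_fst'[symmetric]) (unfold joint, rule integrable_distr_eq[OF VZ h, THEN iffD2, OF e_int])
  also have "\<dots> = (\<integral>v. 0 \<partial>P)"
  proof (rule Bochner_Integration.integral_cong[OF refl])
    fix v assume "v \<in> space P"
    then have v: "v \<in> space ?J" by (simp add: P_def)
    have Bv: "Pair v -` B \<in> sets N" by (rule sets_Pair1[OF B])
    have "(\<lambda>z. h (v, z)) \<in> borel_measurable ?S"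
      by (rule measurable_compose[OF measurable_Pair1'[OF v] h])
    then have "(\<integral>z. h (v, z) \<partial>Q) = (\<integral>\<omega>. h (v, ?Z \<omega>) \<partial>M)"
      unfolding Q_def by (rule integral_distr[rotated]) (use ind in auto)
    also have "\<dots> = (\<integral>\<omega>. indicator (Pair v -` B) (X i \<omega>) * eps i k \<omega> \<partial>M)"
      unfolding h_def eps_record[OF k] by (simp add: indicator_def)
    also have "\<dots> = 0" by (rule eps_orthogonal_own_covariate[OF i k Bv])
    finally show "(\<integral>z. h (v, z) \<partial>Q) = 0" .
  qed
  finally show ?thesis by simp
qed

lemma eps_orthogonal:
  assumes i: "i \<in> {1..n}" and k: "k \<in> {1..m}" and Z: "Z \<in> borel_measurable (others i)"
    and int: "integrable M (\<lambda>\<omega>. Z \<omega> * eps i k \<omega>)"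
  shows "(\<integral>\<omega>. Z \<omega> * eps i k \<omega> \<partial>M) = 0"
  using integral_mult_eq_on_subalgebra[OF subalgebra_others[OF i] Z eps_integrable[OF i k], of "\<lambda>_. 0"]
    eps_integral_over_others[OF i k] int by simp

lemma eps_mean_zero: "i \<in> {1..n} \<Longrightarrow> k \<in> {1..m} \<Longrightarrow> (\<integral>\<omega>. eps i k \<omega> \<partial>M) = 0"
  using eps_orthogonal[of i k "\<lambda>_. 1"] eps_integrable by simp

end

section \<open>The randomized assignment\<close>

text \<open>
  The optimal value, which is to be inserted for \<open>B\<close>, may fail to be measurable in the covariates. The
  constant is therefore moved out of the integral of \<open>u\<close>.
\<close>

lemma nn_integral_le_cmult:
  assumes u: "u \<in> borel_measurable M" and le: "AE \<omega> in M. u \<omega> \<le> ennreal c * B \<omega>" and c: "c \<ge> 0"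
  shows "(\<integral>\<^sup>+\<omega>. u \<omega> \<partial>M) \<le> ennreal c * (\<integral>\<^sup>+\<omega>. B \<omega> \<partial>M)"
proof (cases "c = 0")
  case True
  then have "(\<integral>\<^sup>+\<omega>. u \<omega> \<partial>M) \<le> (\<integral>\<^sup>+\<omega>. 0 \<partial>M)"
    using le by (intro nn_integral_mono_AE) (auto elim!: eventually_mono)
  then show ?thesis by simp
next
  case False
  have cancel: "ennreal c * (ennreal (1 / c) * z) = z" "ennreal (1 / c) * (ennreal c * z) = z" for z
    using False c by (simp_all add: mult.assoc[symmetric] ennreal_mult[symmetric])
  have "(\<integral>\<^sup>+\<omega>. u \<omega> \<partial>M) = (\<integral>\<^sup>+\<omega>. ennreal c * (ennreal (1 / c) * u \<omega>) \<partial>M)"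
    by (simp only: cancel)
  also have "\<dots> = ennreal c * (\<integral>\<^sup>+\<omega>. ennreal (1 / c) * u \<omega> \<partial>M)"
    by (rule nn_integral_cmult) (use u in measurable)
  also have "\<dots> \<le> ennreal c * (\<integral>\<^sup>+\<omega>. B \<omega> \<partial>M)"
  proof (intro mult_left_mono nn_integral_mono_AE)
    show "AE \<omega> in M. ennreal (1 / c) * u \<omega> \<le> B \<omega>"
      using le
    proof eventually_elim
      case (elim \<omega>)
      then have "ennreal (1 / c) * u \<omega> \<le> ennreal (1 / c) * (ennreal c * B \<omega>)"
        by (rule mult_left_mono) simp
      then show ?case by (simp only: cancel)
    qed
  qed simp
  finally show ?thesis .
qed

lemma (in finite_measure) integrable_indicator_real:
  "A \<in> sets M \<Longrightarrow> integrable M (indicator A :: 'a \<Rightarrow> real)"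
  by (intro integrable_real_indicator) (auto simp: less_top[symmetric])

lemma (in prob_space) variance_le_second_moment:
  assumes "square_integrable M T"
  shows "variance T \<le> (\<integral>\<omega>. (T \<omega> - c)\<^sup>2 \<partial>M)"
proof -
  have T: "integrable M T" "integrable M (\<lambda>\<omega>. (T \<omega>)\<^sup>2)"
    using assms square_integrable_integrable[OF assms] by (auto simp: square_integrable_def)
  have "(\<integral>\<omega>. (T \<omega> - c)\<^sup>2 \<partial>M) = (\<integral>\<omega>. (T \<omega>)\<^sup>2 - 2 * c * T \<omega> + c\<^sup>2 \<partial>M)"
    by (simp add: power2_diff algebra_simps)
  also have "\<dots> = expectation (\<lambda>\<omega>. (T \<omega>)\<^sup>2) - 2 * c * expectation T + c\<^sup>2"
    using T by (simp add: prob_space)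
  also have "\<dots> = variance T + (expectation T - c)\<^sup>2"
    using variance_eq[OF T] by (simp add: power2_diff)
  finally show ?thesis by simp
qed

locale randomized_experiment = iid_sample M N m n X Y f
  for M :: "'a measure" and N :: "'x measure" and m n :: nat
    and X :: "nat \<Rightarrow> 'a \<Rightarrow> 'x" and Y :: "nat \<Rightarrow> nat \<Rightarrow> 'a \<Rightarrow> real" and f :: "nat \<Rightarrow> 'x \<Rightarrow> real" +
  fixes p :: nat and W :: "'a \<Rightarrow> nat \<Rightarrow> nat" and D :: "(nat \<Rightarrow> 'x) \<Rightarrow> (nat \<Rightarrow> nat) pmf"
  assumes p_pos: "p \<ge> 1" and n_eq: "n = m * p"
    and drawn: "drawn_from_design M N m n X Y W D"
    and design_symmetric: "\<And>\<omega>. \<omega> \<in> space M \<Longrightarrow> D (covariates n X \<omega>) \<in> mixed_strategies m p n"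
begin

definition covariate_algebra :: "'a measure" where
  "covariate_algebra = generated M (covariates n X) (PiM {1..n} (\<lambda>_. N))"

definition outcome_algebra :: "'a measure" where
  "outcome_algebra = generated M (all_outcomes m n Y) (PiM {1..n} (\<lambda>_. outcome_space m))"

definition assigned :: "(nat \<Rightarrow> nat) \<Rightarrow> 'a set" where
  "assigned w = {\<omega> \<in> space M. W \<omega> = w}"

text \<open>
  The weight of an assignment given the covariates. The probability prescribed by the design agrees
  with it almost surely, but only the conditional probability is measurable by construction.
\<close>

definition wt :: "(nat \<Rightarrow> nat) \<Rightarrow> 'a \<Rightarrow> real" where
  "wt w = cond_prob_given M covariate_algebra (assigned w)"

lemma W_measurable: "W \<in> measurable M (count_space (assignments m n))"
  using drawn by (simp add: drawn_from_design_def)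

lemma finite_assignments: "finite (assignments m n)"
  unfolding assignments_def by (auto intro: finite_PiE)

lemma balanced_assignments: "balanced m p n \<subseteq> assignments m n"
  by (auto simp: balanced_def)

lemma subalgebra_covariate: "subalgebra M covariate_algebra"
  unfolding covariate_algebra_def by (rule subalgebra_generated[OF covariates_measurable])

lemma subalgebra_outcome: "subalgebra M outcome_algebra"
  unfolding outcome_algebra_def by (rule subalgebra_generated[OF all_outcomes_measurable])

lemma wt_measurable_covariate: "wt w \<in> borel_measurable covariate_algebra"
  unfolding wt_def cond_prob_given_def by (rule borel_measurable_cond_exp)

lemma wt_measurable [measurable]: "wt w \<in> borel_measurable M"
  by (rule measurable_from_subalg[OF subalgebra_covariate wt_measurable_covariate])

lemma wt_measurable_others: "i \<in> {1..n} \<Longrightarrow> wt w \<in> borel_measurable (others i)"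
  using borel_measurable_generated_trans[OF wt_measurable_covariate[unfolded covariate_algebra_def]
      covariates_measurable_others] subalgebra_others[of i]
  by (simp add: subalgebra_def)

lemma AE_wt: "AE \<omega> in M. \<forall>w\<in>assignments m n. wt w \<omega> = pmf (D (covariates n X \<omega>)) w"
proof (rule AE_finite_allI[OF finite_assignments])
  fix w assume "w \<in> assignments m n"
  then show "AE \<omega> in M. wt w \<omega> = pmf (D (covariates n X \<omega>)) w"
    using drawn unfolding drawn_from_design_def Let_def wt_def assigned_def covariate_algebra_def by blast
qed

lemma wt_bounded: "w \<in> assignments m n \<Longrightarrow> AE \<omega> in M. \<bar>wt w \<omega>\<bar> \<le> 1"
  using AE_wt by eventually_elim (simp add: pmf_le_1)

lemma assigned_sets: "w \<in> assignments m n \<Longrightarrow> assigned w \<in> sets M"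
  using measurable_sets[OF W_measurable, of "{w}"] unfolding assigned_def
  by (simp add: vimage_def Int_def conj_commute)

lemma cond_prob_integrable:
  assumes "A \<in> sets M"
  shows "integrable M (cond_prob_given M covariate_algebra A)"
    "(\<integral>\<omega>. cond_prob_given M covariate_algebra A \<omega> \<partial>M) = measure M A"
proof -
  interpret G: finite_measure_subalgebra M covariate_algebra
    by unfold_locales (rule subalgebra_covariate)
  have "integrable M (indicator A :: 'a \<Rightarrow> real)"
    by (rule integrable_indicator_real[OF assms])
  from G.real_cond_exp_int[OF this]
  show "integrable M (cond_prob_given M covariate_algebra A)"
    "(\<integral>\<omega>. cond_prob_given M covariate_algebra A \<omega> \<partial>M) = measure M A"
    using assms unfolding cond_prob_given_def by (simp_all add: sets.Int_space_eq2)
qed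

text \<open>
  Given the covariates, the assignment is independent of the outcomes; for an event \<open>A\<close> of the outcomes
  the conditional probability of \<open>A\<close> can be replaced by its indicator, because the weight is a function
  of the covariates. In effect this removes \<open>W\<close> from all further computations.
\<close>

lemma randomization:
  assumes w: "w \<in> assignments m n" and Z: "Z \<in> borel_measurable outcome_algebra" and int: "integrable M Z"
  shows "(\<integral>\<omega>. Z \<omega> * indicator (assigned w) \<omega> \<partial>M) = (\<integral>\<omega>. Z \<omega> * wt w \<omega> \<partial>M)"
proof (rule integral_mult_eq_on_subalgebra[OF subalgebra_outcome Z])
  interpret G: finite_measure_subalgebra M covariate_algebra
    by unfold_locales (rule subalgebra_covariate)
  note a = assigned_sets[OF w]
  show "integrable M (indicator (assigned w) :: 'a \<Rightarrow> real)"
    by (rule integrable_indicator_real[OF a])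
  show "integrable M (wt w)" unfolding wt_def by (rule cond_prob_integrable(1)[OF a])
  show "integrable M (\<lambda>\<omega>. Z \<omega> * indicator (assigned w) \<omega>)"
    using integrable_mult_indicator[OF a int] by (simp add: mult.commute)
  show "integrable M (\<lambda>\<omega>. Z \<omega> * wt w \<omega>)"
    using integrable_bounded_mult[OF wt_measurable wt_bounded[OF w] int] by (simp add: mult.commute)
  fix A assume "A \<in> sets outcome_algebra"
  then have A: "A \<in> sets (generated M (all_outcomes m n Y) (PiM {1..n} (\<lambda>_. outcome_space m)))"
    "A \<in> sets M"
    using subalgebra_outcome by (auto simp: outcome_algebra_def subalgebra_def)
  have "assigned w \<in> sets (generated M W (count_space (assignments m n)))"
    using in_vimage_algebra[of "{w}" "count_space (assignments m n)" W "space M"] w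
    unfolding generated_def assigned_def by (simp add: vimage_def Int_def conj_commute)
  then have indep: "AE \<omega> in M. cond_prob_given M covariate_algebra (assigned w \<inter> A) \<omega>
      = wt w \<omega> * cond_prob_given M covariate_algebra A \<omega>"
    using drawn A(1) unfolding drawn_from_design_def Let_def cond_indep_def wt_def covariate_algebra_def
    by blast
  have wtA: "integrable M (\<lambda>\<omega>. wt w \<omega> * indicator A \<omega>)"
    by (rule integrable_bounded_mult[OF wt_measurable wt_bounded[OF w] integrable_indicator_real[OF A(2)]])
  have "(\<integral>\<omega>. indicator A \<omega> * indicator (assigned w) \<omega> \<partial>M) = (measure M (assigned w \<inter> A) :: real)"
    using a A by (simp add: indicator_inter_arith[symmetric] Int_commute sets.Int_space_eq2)
  also have "\<dots> = (\<integral>\<omega>. cond_prob_given M covariate_algebra (assigned w \<inter> A) \<omega> \<partial>M)"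
    using a A by (intro cond_prob_integrable(2)[symmetric]) auto
  also have "\<dots> = (\<integral>\<omega>. wt w \<omega> * cond_prob_given M covariate_algebra A \<omega> \<partial>M)"
  proof (rule integral_cong_AE[OF _ _ indep])
    show "cond_prob_given M covariate_algebra (assigned w \<inter> A) \<in> borel_measurable M"
      using a A cond_prob_integrable(1)[of "assigned w \<inter> A"] by auto
    show "(\<lambda>\<omega>. wt w \<omega> * cond_prob_given M covariate_algebra A \<omega>) \<in> borel_measurable M"
      using cond_prob_integrable(1)[OF A(2)] by auto
  qed
  also have "\<dots> = (\<integral>\<omega>. wt w \<omega> * indicator A \<omega> \<partial>M)"
    unfolding cond_prob_given_def
    by (rule G.real_cond_exp_intg(2)[OF wtA wt_measurable_covariate]) (use A in simp)
  finally show "(\<integral>\<omega>. indicator A \<omega> * indicator (assigned w) \<omega> \<partial>M) = (\<integral>\<omega>. indicator A \<omega> * wt w \<omega> \<partial>M)"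
    by (simp add: mult.commute)
qed

text \<open>
  Unbalanced assignments have probability zero, so that the sum runs over the balanced ones only.
\<close>

lemma assigned_outcome:
  assumes \<Phi>: "\<And>w. w \<in> assignments m n \<Longrightarrow> \<Phi> w \<in> borel_measurable outcome_algebra"
      "\<And>w. w \<in> assignments m n \<Longrightarrow> integrable M (\<Phi> w)"
  shows "integrable M (\<lambda>\<omega>. \<Phi> (W \<omega>) \<omega> :: real)"
    and "(\<integral>\<omega>. \<Phi> (W \<omega>) \<omega> \<partial>M) = (\<Sum>w\<in>balanced m p n. \<integral>\<omega>. wt w \<omega> * \<Phi> w \<omega> \<partial>M)"
proof -
  have eq: "\<Phi> (W \<omega>) \<omega> = (\<Sum>w\<in>assignments m n. \<Phi> w \<omega> * indicator (assigned w) \<omega>)"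
    if "\<omega> \<in> space M" for \<omega>
  proof -
    have "W \<omega> \<in> assignments m n" using measurable_space[OF W_measurable that] by simp
    then show ?thesis
      using that finite_assignments by (simp add: assigned_def indicator_def if_distrib cong: if_cong)
  qed
  have int: "integrable M (\<lambda>\<omega>. \<Phi> w \<omega> * indicator (assigned w) \<omega>)" if "w \<in> assignments m n" for w
    using integrable_mult_indicator[OF assigned_sets[OF that] \<Phi>(2)[OF that]] by (simp add: mult.commute)
  show "integrable M (\<lambda>\<omega>. \<Phi> (W \<omega>) \<omega>)"
    using int by (subst Bochner_Integration.integrable_cong[OF refl eq]) auto
  have "(\<integral>\<omega>. \<Phi> (W \<omega>) \<omega> \<partial>M) = (\<Sum>w\<in>assignments m n. \<integral>\<omega>. \<Phi> w \<omega> * indicator (assigned w) \<omega> \<partial>M)"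
    using int by (subst Bochner_Integration.integral_cong[OF refl eq]) auto
  also have "\<dots> = (\<Sum>w\<in>assignments m n. \<integral>\<omega>. wt w \<omega> * \<Phi> w \<omega> \<partial>M)"
    using \<Phi> by (intro sum.cong) (simp_all add: randomization mult.commute)
  also have "\<dots> = (\<Sum>w\<in>balanced m p n. \<integral>\<omega>. wt w \<omega> * \<Phi> w \<omega> \<partial>M)"
  proof (rule sum.mono_neutral_right[OF finite_assignments balanced_assignments], rule ballI)
    fix w assume w: "w \<in> assignments m n - balanced m p n"
    have "AE \<omega> in M. wt w \<omega> * \<Phi> w \<omega> = 0"
      using AE_wt AE_space
    proof eventually_elim
      case (elim \<omega>)
      then have "wt w \<omega> = 0"
        using design_symmetric[of \<omega>] w by (auto simp: mixed_strategies_def set_pmf_iff)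
      then show ?case by simp
    qed
    then show "(\<integral>\<omega>. wt w \<omega> * \<Phi> w \<omega> \<partial>M) = 0" by (rule integral_eq_zero_AE)
  qed
  finally show "(\<integral>\<omega>. \<Phi> (W \<omega>) \<omega> \<partial>M) = (\<Sum>w\<in>balanced m p n. \<integral>\<omega>. wt w \<omega> * \<Phi> w \<omega> \<partial>M)" .
qed

text \<open>
  The design mean may fail to be measurable in \<open>\<omega>\<close>; where it has a closed form \<open>g\<close> that is measurable,
  the weights can be summed out under the integral.
\<close>

lemma sum_wt_integral:
  assumes int: "\<And>w. w \<in> balanced m p n \<Longrightarrow> integrable M (\<lambda>\<omega>. wt w \<omega> * \<Psi> w \<omega>)"
    and g: "g \<in> borel_measurable M"
    and eq: "\<And>\<omega>. \<omega> \<in> space M \<Longrightarrow> design_mean m p n (D (covariates n X \<omega>)) (\<lambda>w. \<Psi> w \<omega>) = g \<omega>"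
  shows "(\<Sum>w\<in>balanced m p n. \<integral>\<omega>. wt w \<omega> * \<Psi> w \<omega> \<partial>M) = (\<integral>\<omega>. g \<omega> \<partial>M)"
proof -
  have "(\<Sum>w\<in>balanced m p n. \<integral>\<omega>. wt w \<omega> * \<Psi> w \<omega> \<partial>M) = (\<integral>\<omega>. (\<Sum>w\<in>balanced m p n. wt w \<omega> * \<Psi> w \<omega>) \<partial>M)"
    using int by simp
  also have "\<dots> = (\<integral>\<omega>. g \<omega> \<partial>M)"
  proof (rule integral_cong_AE[OF _ g])
    show "(\<lambda>\<omega>. \<Sum>w\<in>balanced m p n. wt w \<omega> * \<Psi> w \<omega>) \<in> borel_measurable M"
      using int by (intro borel_measurable_sum) auto
    show "AE \<omega> in M. (\<Sum>w\<in>balanced m p n. wt w \<omega> * \<Psi> w \<omega>) = g \<omega>"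
      using AE_wt AE_space
    proof eventually_elim
      case (elim \<omega>)
      then have "(\<Sum>w\<in>balanced m p n. wt w \<omega> * \<Psi> w \<omega>)
          = design_mean m p n (D (covariates n X \<omega>)) (\<lambda>w. \<Psi> w \<omega>)"
        using balanced_assignments by (intro sum.cong) auto
      then show ?case using eq elim by simp
    qed
  qed
  finally show ?thesis .
qed

lemma wt_mult_integrable:
  assumes "w \<in> balanced m p n" "square_integrable M u" "square_integrable M v"
  shows "integrable M (\<lambda>\<omega>. wt w \<omega> * (u \<omega> * v \<omega>))"
  using assms balanced_assignments
  by (intro integrable_bounded_mult[OF wt_measurable wt_bounded] square_integrable_mult) auto

lemma wt_square_integrable:
  assumes "w \<in> balanced m p n" "square_integrable M u"
  shows "square_integrable M (\<lambda>\<omega>. wt w \<omega> * u \<omega>)"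
  using assms balanced_assignments
  by (intro square_integrable_bounded_mult[OF wt_measurable wt_bounded]) auto

end

section \<open>The variance of the estimator\<close>

locale treatment_comparison = randomized_experiment M N m n X Y f p W D
  for M :: "'a measure" and N :: "'x measure" and m n :: nat
    and X :: "nat \<Rightarrow> 'a \<Rightarrow> 'x" and Y :: "nat \<Rightarrow> nat \<Rightarrow> 'a \<Rightarrow> real" and f :: "nat \<Rightarrow> 'x \<Rightarrow> real"
    and p :: nat and W :: "'a \<Rightarrow> nat \<Rightarrow> nat" and D :: "(nat \<Rightarrow> 'x) \<Rightarrow> (nat \<Rightarrow> nat) pmf" +
  fixes k k' :: nat
  assumes k: "k \<in> {1..m}" and k': "k' \<in> {1..m}" and kk': "k \<noteq> k'"
begin

text \<open>
  The common mean of the outcome differences, which is also the mean of the estimator.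
\<close>

definition effect :: real where
  "effect = (\<integral>\<omega>. f k (X 1 \<omega>) - f k' (X 1 \<omega>) \<partial>M)"

definition centered :: "nat \<Rightarrow> 'a \<Rightarrow> real" where
  "centered i \<omega> = f k (X i \<omega>) - f k' (X i \<omega>) - effect"

text \<open>
  The three summands of the estimation error at a fixed assignment are \<open>imbalance_part\<close>,
  \<open>sample_part\<close> and \<open>noise_part\<close>.
\<close>

definition sample_part :: "'a \<Rightarrow> real" where
  "sample_part \<omega> = (\<Sum>i=1..n. centered i \<omega>) / real n"

definition imbalance_part :: "(nat \<Rightarrow> nat) \<Rightarrow> 'a \<Rightarrow> real" where
  "imbalance_part w \<omega> = group_deviation p n (covariates n X \<omega>) w (f k) k
     - group_deviation p n (covariates n X \<omega>) w (f k') k'"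

definition noise :: "(nat \<Rightarrow> nat) \<Rightarrow> nat \<Rightarrow> 'a \<Rightarrow> real" where
  "noise w i \<omega> = (of_bool (w i = k) * eps i k \<omega> - of_bool (w i = k') * eps i k' \<omega>) / real p"

definition noise_part :: "(nat \<Rightarrow> nat) \<Rightarrow> 'a \<Rightarrow> real" where
  "noise_part w \<omega> = (\<Sum>i=1..n. noise w i \<omega>)"

lemma estimator_decomposition:
  "tau_hat p n Y (\<lambda>_. w) k k' \<omega> - effect = imbalance_part w \<omega> + sample_part \<omega> + noise_part w \<omega>"
proof -
  have split: "(\<Sum>i | i \<in> {1..n} \<and> w i = l. Y i l \<omega>)
      = (\<Sum>i | i \<in> {1..n} \<and> w i = l. f l (covariates n X \<omega> i)) + (\<Sum>i=1..n. of_bool (w i = l) * eps i l \<omega>)"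
    for l
  proof -
    have "(\<Sum>i=1..n. of_bool (w i = l) * eps i l \<omega>) = (\<Sum>i=1..n. if w i = l then eps i l \<omega> else 0)"
      by (rule sum.cong) auto
    also have "\<dots> = (\<Sum>i | i \<in> {1..n} \<and> w i = l. eps i l \<omega>)"
      using sum.inter_filter[of "{1..n}" "\<lambda>i. eps i l \<omega>" "\<lambda>i. w i = l"] by simp
    finally have "(\<Sum>i | i \<in> {1..n} \<and> w i = l. f l (covariates n X \<omega> i)) + (\<Sum>i=1..n. of_bool (w i = l) * eps i l \<omega>)
        = (\<Sum>i | i \<in> {1..n} \<and> w i = l. f l (covariates n X \<omega> i) + eps i l \<omega>)"
      by (simp add: sum.distrib)
    also have "\<dots> = (\<Sum>i | i \<in> {1..n} \<and> w i = l. Y i l \<omega>)"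
      by (rule sum.cong) (auto simp: residual_def covariates_def)
    finally show ?thesis ..
  qed
  have cov: "(\<Sum>i=1..n. g (covariates n X \<omega> i)) = (\<Sum>i=1..n. g (X i \<omega>))" for g :: "'x \<Rightarrow> real"
    by (rule sum.cong) (auto simp: covariates_def)
  have "sample_part \<omega> = (\<Sum>i=1..n. f k (X i \<omega>)) / real n - (\<Sum>i=1..n. f k' (X i \<omega>)) / real n - effect"
    using n_pos by (simp add: sample_part_def centered_def sum_subtractf diff_divide_distrib)
  moreover have "noise_part w \<omega> = 1 / real p * (\<Sum>i=1..n. of_bool (w i = k) * eps i k \<omega>)
      - 1 / real p * (\<Sum>i=1..n. of_bool (w i = k') * eps i k' \<omega>)"
    unfolding noise_part_def noise_def by (simp only: sum_subtractf diff_divide_distrib sum_divide_distrib times_divide_eq_left mult_1)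
  ultimately show ?thesis
    unfolding tau_hat_def split imbalance_part_def group_deviation_def group_mean_def cov
    by (simp add: distrib_left)
qed

lemma centered_square_integrable: "i \<in> {1..n} \<Longrightarrow> square_integrable M (centered i)"
  unfolding centered_def by (intro square_integrable_diff f_square_integrable square_integrable_const k k')

lemma sample_part_square_integrable: "square_integrable M sample_part"
proof -
  have "sample_part = (\<lambda>\<omega>. 1 / real n * (\<Sum>i=1..n. centered i \<omega>))"
    by (simp add: sample_part_def fun_eq_iff)
  then show ?thesis
    by (simp only:) (intro square_integrable_cmult square_integrable_sum centered_square_integrable)
qed

lemma noise_square_integrable: "i \<in> {1..n} \<Longrightarrow> square_integrable M (noise w i)"
  using square_integrable_cmult[OF square_integrable_diff[OF
      square_integrable_cmult[OF eps_square_integrable[of i k]]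
      square_integrable_cmult[OF eps_square_integrable[of i k']]], of "1 / real p"] k k'
  by (simp add: noise_def[abs_def])

lemma noise_part_square_integrable: "square_integrable M (noise_part w)"
  unfolding noise_part_def[abs_def] by (rule square_integrable_sum[OF noise_square_integrable]) simp

lemma group_deviation_covariates:
  "group_deviation p n (covariates n X \<omega>) w g l =
     1 / real p * (\<Sum>i | i \<in> {1..n} \<and> w i = l. g (X i \<omega>)) - 1 / real n * (\<Sum>i=1..n. g (X i \<omega>))"
proof -
  have "(\<Sum>i\<in>I. g (covariates n X \<omega> i)) = (\<Sum>i\<in>I. g (X i \<omega>))" if "I \<subseteq> {1..n}" for I
    using that by (intro sum.cong) (auto simp: covariates_def)
  then show ?thesis
    by (simp add: group_deviation_def group_mean_def subset_eq)
qed

lemma imbalance_part_square_integrable: "square_integrable M (imbalance_part w)"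
  unfolding imbalance_part_def[abs_def] group_deviation_covariates
  by (intro square_integrable_diff square_integrable_cmult square_integrable_sum f_square_integrable k k') auto

lemma imbalance_part_measurable_others: "i \<in> {1..n} \<Longrightarrow> imbalance_part w \<in> borel_measurable (others i)"
  unfolding imbalance_part_def[abs_def] group_deviation_covariates
  by (intro borel_measurable_diff borel_measurable_times borel_measurable_const borel_measurable_sum
      f_measurable_others k k') auto

lemma centered_measurable_others:
  "i \<in> {1..n} \<Longrightarrow> j \<in> {1..n} \<Longrightarrow> centered j \<in> borel_measurable (others i)"
  unfolding centered_def[abs_def]
  by (intro borel_measurable_diff borel_measurable_const f_measurable_others k k')

lemma sample_part_measurable_others: "i \<in> {1..n} \<Longrightarrow> sample_part \<in> borel_measurable (others i)"
  unfolding sample_part_def[abs_def]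
  by (intro borel_measurable_divide borel_measurable_const borel_measurable_sum centered_measurable_others)

lemma noise_measurable_others:
  assumes "i \<in> {1..n}" "j \<in> {1..n}" "j \<noteq> i"
  shows "noise w j \<in> borel_measurable (others i)"
  unfolding noise_def[abs_def]
  by (intro borel_measurable_divide borel_measurable_diff borel_measurable_times borel_measurable_const
      eps_measurable_others assms k k')

lemma noise_orthogonal:
  assumes i: "i \<in> {1..n}" and Z: "Z \<in> borel_measurable (others i)" "square_integrable M Z"
  shows "(\<integral>\<omega>. Z \<omega> * noise w i \<omega> \<partial>M) = 0"
proof -
  have int: "integrable M (\<lambda>\<omega>. Z \<omega> * eps i l \<omega>)" if "l \<in> {1..m}" for l
    by (rule square_integrable_mult[OF Z(2) eps_square_integrable[OF i that]])
  have "(\<integral>\<omega>. Z \<omega> * noise w i \<omega> \<partial>M) = (\<integral>\<omega>. of_bool (w i = k) / real p * (Z \<omega> * eps i k \<omega>)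
      - of_bool (w i = k') / real p * (Z \<omega> * eps i k' \<omega>) \<partial>M)"
    by (rule Bochner_Integration.integral_cong) (simp_all add: noise_def right_diff_distrib diff_divide_distrib)
  also have "\<dots> = of_bool (w i = k) / real p * (\<integral>\<omega>. Z \<omega> * eps i k \<omega> \<partial>M)
      - of_bool (w i = k') / real p * (\<integral>\<omega>. Z \<omega> * eps i k' \<omega> \<partial>M)"
    using int[OF k] int[OF k'] by (subst Bochner_Integration.integral_diff) auto
  also have "\<dots> = 0"
    using eps_orthogonal[OF i k Z(1) int[OF k]] eps_orthogonal[OF i k' Z(1) int[OF k']] by simp
  finally show ?thesis .
qed

text \<open>
  The imbalance and the sample mean depend on the covariates only, hence each residual is orthogonal to
  them, with the weight included.
\<close>

lemma noise_part_orthogonal: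
  assumes w: "w \<in> balanced m p n"
  shows "(\<integral>\<omega>. wt w \<omega> * ((imbalance_part w \<omega> + sample_part \<omega>) * noise_part w \<omega>) \<partial>M) = 0"
proof -
  let ?Z = "\<lambda>\<omega>. wt w \<omega> * (imbalance_part w \<omega> + sample_part \<omega>)"
  have sq: "square_integrable M ?Z"
    by (intro wt_square_integrable[OF w] square_integrable_add imbalance_part_square_integrable
        sample_part_square_integrable)
  have "(\<integral>\<omega>. wt w \<omega> * ((imbalance_part w \<omega> + sample_part \<omega>) * noise_part w \<omega>) \<partial>M)
      = (\<integral>\<omega>. (\<Sum>i=1..n. ?Z \<omega> * noise w i \<omega>) \<partial>M)"
    by (simp add: noise_part_def sum_distrib_left mult.assoc)
  also have "\<dots> = (\<Sum>i=1..n. \<integral>\<omega>. ?Z \<omega> * noise w i \<omega> \<partial>M)"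
    by (rule Bochner_Integration.integral_sum) (intro square_integrable_mult sq noise_square_integrable)
  also have "\<dots> = 0"
    by (intro sum.neutral ballI noise_orthogonal sq borel_measurable_times borel_measurable_add
        wt_measurable_others imbalance_part_measurable_others sample_part_measurable_others)
  finally show ?thesis .
qed

text \<open>
  Residuals of different subjects are orthogonal, and remain so with a weight that depends on the
  covariates.
\<close>

lemma noise_part_second_moment:
  assumes w: "w \<in> balanced m p n"
  shows "(\<integral>\<omega>. wt w \<omega> * (noise_part w \<omega> * noise_part w \<omega>) \<partial>M)
    = (\<Sum>i=1..n. \<integral>\<omega>. wt w \<omega> * (noise w i \<omega> * noise w i \<omega>) \<partial>M)"
proof -
  have sq: "square_integrable M (\<lambda>\<omega>. wt w \<omega> * noise w i \<omega>)" if "i \<in> {1..n}" for i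
    by (rule wt_square_integrable[OF w noise_square_integrable[OF that]])
  have int: "integrable M (\<lambda>\<omega>. (wt w \<omega> * noise w j \<omega>) * noise w i \<omega>)" if "i \<in> {1..n}" "j \<in> {1..n}" for i j
    by (rule square_integrable_mult[OF sq noise_square_integrable]) (use that in auto)
  have "(\<integral>\<omega>. wt w \<omega> * (noise_part w \<omega> * noise_part w \<omega>) \<partial>M)
      = (\<integral>\<omega>. (\<Sum>i=1..n. \<Sum>j=1..n. (wt w \<omega> * noise w j \<omega>) * noise w i \<omega>) \<partial>M)"
    unfolding noise_part_def sum_product
    by (intro Bochner_Integration.integral_cong refl) (simp add: sum_distrib_left mult_ac)
  also have "\<dots> = (\<Sum>i=1..n. \<integral>\<omega>. (\<Sum>j=1..n. (wt w \<omega> * noise w j \<omega>) * noise w i \<omega>) \<partial>M)"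
    by (rule Bochner_Integration.integral_sum) (intro Bochner_Integration.integrable_sum int)
  also have "\<dots> = (\<Sum>i=1..n. \<Sum>j=1..n. \<integral>\<omega>. (wt w \<omega> * noise w j \<omega>) * noise w i \<omega> \<partial>M)"
    by (intro sum.cong refl Bochner_Integration.integral_sum int)
  also have "\<dots> = (\<Sum>i=1..n. \<Sum>j=1..n. if j = i then \<integral>\<omega>. wt w \<omega> * (noise w i \<omega> * noise w i \<omega>) \<partial>M else 0)"
  proof (intro sum.cong refl)
    fix i j assume ij: "i \<in> {1..n}" "j \<in> {1..n}"
    show "(\<integral>\<omega>. (wt w \<omega> * noise w j \<omega>) * noise w i \<omega> \<partial>M)
        = (if j = i then \<integral>\<omega>. wt w \<omega> * (noise w i \<omega> * noise w i \<omega>) \<partial>M else 0)"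
    proof (cases "j = i")
      case False
      then have "(\<lambda>\<omega>. wt w \<omega> * noise w j \<omega>) \<in> borel_measurable (others i)"
        using ij by (intro borel_measurable_times wt_measurable_others noise_measurable_others)
      from noise_orthogonal[OF ij(1) this sq[OF ij(2)]] show ?thesis using False by simp
    qed (simp add: mult.assoc)
  qed
  finally show ?thesis by simp
qed

text \<open>
  A subject contributes noise through at most one of its two residuals, each with probability \<open>1/m\<close>
  given the covariates.
\<close>

lemma noise_second_moment:
  assumes i: "i \<in> {1..n}"
  shows "(\<Sum>w\<in>balanced m p n. \<integral>\<omega>. wt w \<omega> * (noise w i \<omega> * noise w i \<omega>) \<partial>M)
    = ((\<integral>\<omega>. (eps 1 k \<omega>)\<^sup>2 \<partial>M) + (\<integral>\<omega>. (eps 1 k' \<omega>)\<^sup>2 \<partial>M)) / (real m * (real p)\<^sup>2)"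
proof -
  have sq: "integrable M (\<lambda>\<omega>. (eps i k \<omega>)\<^sup>2)" "integrable M (\<lambda>\<omega>. (eps i k' \<omega>)\<^sup>2)"
    using eps_square_integrable[OF i] k k' by (auto simp: square_integrable_def)
  have "(\<Sum>w\<in>balanced m p n. \<integral>\<omega>. wt w \<omega> * (noise w i \<omega> * noise w i \<omega>) \<partial>M)
      = (\<integral>\<omega>. ((eps i k \<omega>)\<^sup>2 + (eps i k' \<omega>)\<^sup>2) / (real m * (real p)\<^sup>2) \<partial>M)"
  proof (rule sum_wt_integral)
    show "integrable M (\<lambda>\<omega>. wt w \<omega> * (noise w i \<omega> * noise w i \<omega>))" if "w \<in> balanced m p n" for w
      by (intro wt_mult_integrable that noise_square_integrable i)
    show "(\<lambda>\<omega>. ((eps i k \<omega>)\<^sup>2 + (eps i k' \<omega>)\<^sup>2) / (real m * (real p)\<^sup>2)) \<in> borel_measurable M"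
      using sq by auto
    fix \<omega> assume \<omega>: "\<omega> \<in> space M"
    let ?\<sigma> = "D (covariates n X \<omega>)"
    have "design_mean m p n ?\<sigma> (\<lambda>w. noise w i \<omega> * noise w i \<omega>)
        = (\<Sum>w\<in>balanced m p n. (eps i k \<omega>)\<^sup>2 / (real p)\<^sup>2 * (pmf ?\<sigma> w * of_bool (w i = k))
            + (eps i k' \<omega>)\<^sup>2 / (real p)\<^sup>2 * (pmf ?\<sigma> w * of_bool (w i = k')))"
    proof (rule sum.cong[OF refl])
      fix w
      show "pmf ?\<sigma> w * (noise w i \<omega> * noise w i \<omega>)
          = (eps i k \<omega>)\<^sup>2 / (real p)\<^sup>2 * (pmf ?\<sigma> w * of_bool (w i = k))
            + (eps i k' \<omega>)\<^sup>2 / (real p)\<^sup>2 * (pmf ?\<sigma> w * of_bool (w i = k'))"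
        using kk' by (cases "w i = k"; cases "w i = k'") (simp_all add: noise_def power2_eq_square)
    qed
    also have "\<dots> = (eps i k \<omega>)\<^sup>2 / (real p)\<^sup>2 * design_mean m p n ?\<sigma> (\<lambda>w. of_bool (w i = k))
        + (eps i k' \<omega>)\<^sup>2 / (real p)\<^sup>2 * design_mean m p n ?\<sigma> (\<lambda>w. of_bool (w i = k'))"
      by (simp only: sum.distrib sum_distrib_left)
    also have "\<dots> = ((eps i k \<omega>)\<^sup>2 + (eps i k' \<omega>)\<^sup>2) / (real m * (real p)\<^sup>2)"
      unfolding design_treatment_probability[OF design_symmetric[OF \<omega>] k i]
        design_treatment_probability[OF design_symmetric[OF \<omega>] k' i]
      by (simp add: add_divide_distrib mult.commute)
    finally show "design_mean m p n ?\<sigma> (\<lambda>w. noise w i \<omega> * noise w i \<omega>)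
        = ((eps i k \<omega>)\<^sup>2 + (eps i k' \<omega>)\<^sup>2) / (real m * (real p)\<^sup>2)" .
  qed
  also have "\<dots> = ((\<integral>\<omega>. (eps i k \<omega>)\<^sup>2 \<partial>M) + (\<integral>\<omega>. (eps i k' \<omega>)\<^sup>2 \<partial>M)) / (real m * (real p)\<^sup>2)"
    using sq by simp
  finally show ?thesis by (simp only: eps_second_moment_eq[OF i k] eps_second_moment_eq[OF i k'])
qed

lemma sum_noise_part_second_moment:
  "(\<Sum>w\<in>balanced m p n. \<integral>\<omega>. wt w \<omega> * (noise_part w \<omega> * noise_part w \<omega>) \<partial>M)
    = ((\<integral>\<omega>. (eps 1 k \<omega>)\<^sup>2 \<partial>M) + (\<integral>\<omega>. (eps 1 k' \<omega>)\<^sup>2 \<partial>M)) / real p"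
proof -
  have "(\<Sum>w\<in>balanced m p n. \<integral>\<omega>. wt w \<omega> * (noise_part w \<omega> * noise_part w \<omega>) \<partial>M)
      = (\<Sum>w\<in>balanced m p n. \<Sum>i=1..n. \<integral>\<omega>. wt w \<omega> * (noise w i \<omega> * noise w i \<omega>) \<partial>M)"
    by (rule sum.cong) (simp_all only: noise_part_second_moment)
  also have "\<dots> = (\<Sum>i=1..n. ((\<integral>\<omega>. (eps 1 k \<omega>)\<^sup>2 \<partial>M) + (\<integral>\<omega>. (eps 1 k' \<omega>)\<^sup>2 \<partial>M)) / (real m * (real p)\<^sup>2))"
    by (subst sum.swap) (intro sum.cong refl noise_second_moment)
  finally show ?thesis
    using k p_pos by (simp add: n_eq power2_eq_square)
qed

text \<open>
  Given the covariates the sample mean is fixed, while a symmetric design makes the imbalance have mean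
  zero.
\<close>

lemma imbalance_sample_orthogonal:
  "(\<Sum>w\<in>balanced m p n. \<integral>\<omega>. wt w \<omega> * (imbalance_part w \<omega> * sample_part \<omega>) \<partial>M) = 0"
proof -
  have "(\<Sum>w\<in>balanced m p n. \<integral>\<omega>. wt w \<omega> * (imbalance_part w \<omega> * sample_part \<omega>) \<partial>M) = (\<integral>\<omega>. 0 \<partial>M)"
  proof (rule sum_wt_integral)
    show "integrable M (\<lambda>\<omega>. wt w \<omega> * (imbalance_part w \<omega> * sample_part \<omega>))" if "w \<in> balanced m p n" for w
      by (intro wt_mult_integrable that imbalance_part_square_integrable sample_part_square_integrable)
    fix \<omega> assume \<omega>: "\<omega> \<in> space M"
    let ?\<sigma> = "D (covariates n X \<omega>)"
    have "design_mean m p n ?\<sigma> (\<lambda>w. imbalance_part w \<omega> * sample_part \<omega>)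
        = sample_part \<omega> * (design_mean m p n ?\<sigma> (\<lambda>w. group_deviation p n (covariates n X \<omega>) w (f k) k)
          - design_mean m p n ?\<sigma> (\<lambda>w. group_deviation p n (covariates n X \<omega>) w (f k') k'))"
      by (simp add: imbalance_part_def sum_subtractf[symmetric] sum_distrib_left right_diff_distrib
          left_diff_distrib mult_ac)
    then show "design_mean m p n ?\<sigma> (\<lambda>w. imbalance_part w \<omega> * sample_part \<omega>) = 0"
      by (simp only: design_mean_group_deviation[OF p_pos n_eq design_symmetric[OF \<omega>] k]
          design_mean_group_deviation[OF p_pos n_eq design_symmetric[OF \<omega>] k'] diff_self mult_zero_right)
  qed simp
  then show ?thesis by simp
qed

lemma sum_wt_sample_part:
  "(\<Sum>w\<in>balanced m p n. \<integral>\<omega>. wt w \<omega> * (sample_part \<omega> * sample_part \<omega>) \<partial>M)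
    = (\<integral>\<omega>. sample_part \<omega> * sample_part \<omega> \<partial>M)"
proof (rule sum_wt_integral)
  show "integrable M (\<lambda>\<omega>. wt w \<omega> * (sample_part \<omega> * sample_part \<omega>))" if "w \<in> balanced m p n" for w
    by (intro wt_mult_integrable that sample_part_square_integrable)
  show "(\<lambda>\<omega>. sample_part \<omega> * sample_part \<omega>) \<in> borel_measurable M"
    using square_integrable_mult[OF sample_part_square_integrable sample_part_square_integrable] by auto
  fix \<omega> assume \<omega>: "\<omega> \<in> space M"
  show "design_mean m p n (D (covariates n X \<omega>)) (\<lambda>w. sample_part \<omega> * sample_part \<omega>)
      = sample_part \<omega> * sample_part \<omega>"
    by (simp only: sum_distrib_right[symmetric] pmf_design_sum[OF design_symmetric[OF \<omega>]] mult_1)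
qed

lemma centered_measurable: "(\<lambda>x. f k x - f k' x - effect) \<in> borel_measurable N"
  by (intro borel_measurable_diff borel_measurable_const f_measurable k k')

lemma centered_mean_zero:
  assumes i: "i \<in> {1..n}"
  shows "(\<integral>\<omega>. centered i \<omega> \<partial>M) = 0"
proof -
  have 1: "1 \<in> {1..n}" using n_pos by simp
  have "(\<integral>\<omega>. centered i \<omega> \<partial>M) = (\<integral>\<omega>. centered 1 \<omega> \<partial>M)"
    using integral_record_eq[OF i measurable_compose[OF measurable_fst centered_measurable]]
    by (simp add: centered_def)
  also have "\<dots> = 0"
    unfolding centered_def effect_def
    using f_square_integrable[OF 1 k] f_square_integrable[OF 1 k']
    by (simp add: square_integrable_integrable prob_space)
  finally show ?thesis .
qed

lemma centered_second_moment_eq: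
  assumes i: "i \<in> {1..n}"
  shows "(\<integral>\<omega>. centered i \<omega> * centered i \<omega> \<partial>M) = (\<integral>\<omega>. centered 1 \<omega> * centered 1 \<omega> \<partial>M)"
  using integral_record_eq[OF i borel_measurable_times[OF
      measurable_compose[OF measurable_fst centered_measurable]
      measurable_compose[OF measurable_fst centered_measurable]]]
  by (simp add: centered_def)

text \<open>
  Covariates of different subjects are independent.
\<close>

lemma centered_uncorrelated:
  assumes i: "i \<in> {1..n}" and j: "j \<in> {1..n}" "j \<noteq> i"
  shows "(\<integral>\<omega>. centered i \<omega> * centered j \<omega> \<partial>M) = 0"
proof -
  have coord: "(\<lambda>z. f k (fst (z l)) - f k' (fst (z l)) - effect) \<in> borel_measurable (PiM {l} (\<lambda>_. record_space))" for l
  proof -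
    have "(\<lambda>z. fst (z l)) \<in> measurable (PiM {l} (\<lambda>_. record_space)) N" by measurable
    from measurable_compose[OF this centered_measurable] show ?thesis .
  qed
  have "indep_var (PiM {i} (\<lambda>_. record_space)) (\<lambda>\<omega>. \<lambda>l\<in>{i}. record_of l \<omega>)
      (PiM {j} (\<lambda>_. record_space)) (\<lambda>\<omega>. \<lambda>l\<in>{j}. record_of l \<omega>)"
    by (rule indep_var_restrict[OF records_indep]) (use i j in auto)
  from indep_var_compose[OF this coord[of i] coord[of j]]
  have "indep_var borel (centered i) borel (centered j)"
    by (simp add: comp_def centered_def[abs_def])
  from indep_var_lebesgue_integral[OF this square_integrable_integrable[OF centered_square_integrable[OF i]]
      square_integrable_integrable[OF centered_square_integrable[OF j(1)]]]
  show ?thesis using centered_mean_zero[OF i] by simp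
qed

lemma sample_part_second_moment:
  "(\<integral>\<omega>. sample_part \<omega> * sample_part \<omega> \<partial>M) = (\<integral>\<omega>. centered 1 \<omega> * centered 1 \<omega> \<partial>M) / real n"
proof -
  have int: "integrable M (\<lambda>\<omega>. centered i \<omega> * centered j \<omega>)" if "i \<in> {1..n}" "j \<in> {1..n}" for i j
    by (intro square_integrable_mult centered_square_integrable that)
  have "(\<integral>\<omega>. sample_part \<omega> * sample_part \<omega> \<partial>M)
      = (\<integral>\<omega>. (\<Sum>i=1..n. \<Sum>j=1..n. centered i \<omega> * centered j \<omega>) / (real n)\<^sup>2 \<partial>M)"
    unfolding sample_part_def by (simp only: times_divide_times_eq sum_product power2_eq_square)
  also have "\<dots> = (\<integral>\<omega>. (\<Sum>i=1..n. \<Sum>j=1..n. centered i \<omega> * centered j \<omega>) \<partial>M) / (real n)\<^sup>2"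
    by (rule integral_divide_zero)
  also have "(\<integral>\<omega>. (\<Sum>i=1..n. \<Sum>j=1..n. centered i \<omega> * centered j \<omega>) \<partial>M)
      = (\<Sum>i=1..n. \<integral>\<omega>. (\<Sum>j=1..n. centered i \<omega> * centered j \<omega>) \<partial>M)"
    by (rule Bochner_Integration.integral_sum) (intro Bochner_Integration.integrable_sum int)
  also have "\<dots> = (\<Sum>i=1..n. \<Sum>j=1..n. \<integral>\<omega>. centered i \<omega> * centered j \<omega> \<partial>M)"
    by (intro sum.cong refl Bochner_Integration.integral_sum int)
  also have "\<dots> = (\<Sum>i=1..n. \<Sum>j=1..n. if j = i then \<integral>\<omega>. centered 1 \<omega> * centered 1 \<omega> \<partial>M else 0)"
  proof (intro sum.cong refl)
    fix i j assume ij: "i \<in> {1..n}" "j \<in> {1..n}"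
    show "(\<integral>\<omega>. centered i \<omega> * centered j \<omega> \<partial>M)
        = (if j = i then \<integral>\<omega>. centered 1 \<omega> * centered 1 \<omega> \<partial>M else 0)"
      using centered_uncorrelated[OF ij] centered_second_moment_eq[OF ij(1)] by (cases "j = i") auto
  qed
  finally show ?thesis
    using n_pos by (simp add: power2_eq_square)
qed

definition estimator :: "(nat \<Rightarrow> nat) \<Rightarrow> 'a \<Rightarrow> real" where
  "estimator w = tau_hat p n Y (\<lambda>_. w) k k'"

lemma Y_measurable_outcome:
  assumes "i \<in> {1..n}" "l \<in> {1..m}"
  shows "Y i l \<in> borel_measurable outcome_algebra"
proof -
  have "all_outcomes m n Y \<in> measurable outcome_algebra (PiM {1..n} (\<lambda>_. outcome_space m))"
    unfolding outcome_algebra_def by (rule measurable_generated[OF all_outcomes_measurable])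
  from measurable_compose[OF measurable_compose[OF this measurable_component_singleton[OF assms(1)]]
      outcome_coord_measurable[OF assms(2)]]
  show ?thesis using assms by (simp add: all_outcomes_def outcomes_def)
qed

lemma estimator_measurable_outcome: "estimator w \<in> borel_measurable outcome_algebra"
  unfolding estimator_def tau_hat_def[abs_def]
  by (intro borel_measurable_diff borel_measurable_times borel_measurable_const borel_measurable_sum
      Y_measurable_outcome k k') auto

lemma estimator_square_integrable: "square_integrable M (estimator w)"
  unfolding estimator_def tau_hat_def[abs_def]
  by (intro square_integrable_diff square_integrable_cmult square_integrable_sum Y_square_integrable k k') auto

lemma tau_hat_eq_estimator: "tau_hat p n Y W k k' \<omega> = estimator (W \<omega>) \<omega>"
  by (simp add: tau_hat_def estimator_def)

lemma estimator_second_moment: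
  assumes w: "w \<in> balanced m p n"
  shows "(\<integral>\<omega>. wt w \<omega> * (estimator w \<omega> - effect)\<^sup>2 \<partial>M)
    = (\<integral>\<omega>. wt w \<omega> * (imbalance_part w \<omega> * imbalance_part w \<omega>) \<partial>M)
      + 2 * (\<integral>\<omega>. wt w \<omega> * (imbalance_part w \<omega> * sample_part \<omega>) \<partial>M)
      + (\<integral>\<omega>. wt w \<omega> * (sample_part \<omega> * sample_part \<omega>) \<partial>M)
      + (\<integral>\<omega>. wt w \<omega> * (noise_part w \<omega> * noise_part w \<omega>) \<partial>M)"
proof -
  note sq = imbalance_part_square_integrable[of w] sample_part_square_integrable noise_part_square_integrable[of w]
  note int = wt_mult_integrable[OF w]
  have "(\<integral>\<omega>. wt w \<omega> * (estimator w \<omega> - effect)\<^sup>2 \<partial>M)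
      = (\<integral>\<omega>. wt w \<omega> * (imbalance_part w \<omega> * imbalance_part w \<omega>)
        + 2 * (wt w \<omega> * (imbalance_part w \<omega> * sample_part \<omega>))
        + wt w \<omega> * (sample_part \<omega> * sample_part \<omega>)
        + 2 * (wt w \<omega> * ((imbalance_part w \<omega> + sample_part \<omega>) * noise_part w \<omega>))
        + wt w \<omega> * (noise_part w \<omega> * noise_part w \<omega>) \<partial>M)"
    unfolding estimator_def estimator_decomposition
    by (intro Bochner_Integration.integral_cong refl) (simp add: power2_eq_square algebra_simps)
  also have "\<dots> = (\<integral>\<omega>. wt w \<omega> * (imbalance_part w \<omega> * imbalance_part w \<omega>) \<partial>M)
      + 2 * (\<integral>\<omega>. wt w \<omega> * (imbalance_part w \<omega> * sample_part \<omega>) \<partial>M)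
      + (\<integral>\<omega>. wt w \<omega> * (sample_part \<omega> * sample_part \<omega>) \<partial>M)
      + 2 * (\<integral>\<omega>. wt w \<omega> * ((imbalance_part w \<omega> + sample_part \<omega>) * noise_part w \<omega>) \<partial>M)
      + (\<integral>\<omega>. wt w \<omega> * (noise_part w \<omega> * noise_part w \<omega>) \<partial>M)"
    using int[OF sq(1) sq(1)] int[OF sq(1) sq(2)] int[OF sq(2) sq(2)] int[OF sq(3) sq(3)]
      int[OF square_integrable_add[OF sq(1) sq(2)] sq(3)]
    by simp
  finally show ?thesis by (simp add: noise_part_orthogonal[OF w])
qed

definition imbalance_moment :: real where
  "imbalance_moment = (\<Sum>w\<in>balanced m p n. \<integral>\<omega>. wt w \<omega> * (imbalance_part w \<omega> * imbalance_part w \<omega>) \<partial>M)"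

text \<open>
  The variance is at most the second moment about any constant, here about \<open>effect\<close>, and the second
  moment splits over the three parts of the estimation error because they are pairwise orthogonal.
\<close>

lemma variance_tau_hat_le:
  "variance (tau_hat p n Y W k k') \<le> imbalance_moment
    + (\<integral>\<omega>. centered 1 \<omega> * centered 1 \<omega> \<partial>M) / real n
    + ((\<integral>\<omega>. (eps 1 k \<omega>)\<^sup>2 \<partial>M) + (\<integral>\<omega>. (eps 1 k' \<omega>)\<^sup>2 \<partial>M)) / real p"
proof -
  have meas: "(\<lambda>\<omega>. estimator w \<omega> ^ 2) \<in> borel_measurable outcome_algebra"
    "(\<lambda>\<omega>. (estimator w \<omega> - effect)\<^sup>2) \<in> borel_measurable outcome_algebra" for w
    by (intro borel_measurable_power borel_measurable_diff borel_measurable_const estimator_measurable_outcome)+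
  have int: "integrable M (estimator w)" "integrable M (\<lambda>\<omega>. (estimator w \<omega>)\<^sup>2)"
    "integrable M (\<lambda>\<omega>. (estimator w \<omega> - effect)\<^sup>2)" for w
    using square_integrable_integrable[OF estimator_square_integrable[of w]] estimator_square_integrable[of w]
      square_integrable_diff[OF estimator_square_integrable[of w] square_integrable_const[of effect]]
    by (simp_all add: square_integrable_def)
  have "square_integrable M (tau_hat p n Y W k k')"
    using assigned_outcome(1)[of estimator] assigned_outcome(1)[of "\<lambda>w \<omega>. (estimator w \<omega>)\<^sup>2"] meas int
      estimator_measurable_outcome
    by (simp add: square_integrable_def tau_hat_eq_estimator[abs_def] borel_measurable_integrable)
  then have "variance (tau_hat p n Y W k k') \<le> (\<integral>\<omega>. (estimator (W \<omega>) \<omega> - effect)\<^sup>2 \<partial>M)"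
    using variance_le_second_moment[of "tau_hat p n Y W k k'" effect] by (simp add: tau_hat_eq_estimator)
  also have "\<dots> = (\<Sum>w\<in>balanced m p n. \<integral>\<omega>. wt w \<omega> * (estimator w \<omega> - effect)\<^sup>2 \<partial>M)"
    by (rule assigned_outcome(2)[of "\<lambda>w \<omega>. (estimator w \<omega> - effect)\<^sup>2"]) (rule meas int)+
  also have "\<dots> = imbalance_moment
    + 2 * (\<Sum>w\<in>balanced m p n. \<integral>\<omega>. wt w \<omega> * (imbalance_part w \<omega> * sample_part \<omega>) \<partial>M)
    + (\<Sum>w\<in>balanced m p n. \<integral>\<omega>. wt w \<omega> * (sample_part \<omega> * sample_part \<omega>) \<partial>M)
    + (\<Sum>w\<in>balanced m p n. \<integral>\<omega>. wt w \<omega> * (noise_part w \<omega> * noise_part w \<omega>) \<partial>M)"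
    unfolding imbalance_moment_def sum_distrib_left sum.distrib[symmetric]
    by (rule sum.cong[OF refl]) (rule estimator_second_moment)
  finally show ?thesis
    by (simp only: imbalance_sample_orthogonal sum_wt_sample_part sample_part_second_moment
        sum_noise_part_second_moment)
qed

text \<open>
  The pointwise bound of \<open>group_deviation_difference_le\<close>, integrated over the covariates.
\<close>

lemma imbalance_moment_le:
  assumes F: "normed_function_space F nrm"
    and eval: "\<And>\<omega> i j. \<omega> \<in> space M \<Longrightarrow> i \<in> {1..n} \<Longrightarrow> j \<in> {1..n} \<Longrightarrow>
           eval_diff_continuous F nrm (X i \<omega>) (X j \<omega>)"
    and controls: "\<And>\<omega>. \<omega> \<in> space M \<Longrightarrow>
      controls_imbalance F nrm m p n (covariates n X \<omega>) (D (covariates n X \<omega>)) (B \<omega>)"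
    and r: "qnorm F nrm (f k) = ennreal r" "r \<ge> 0" and r': "qnorm F nrm (f k') = ennreal r'" "r' \<ge> 0"
  shows "0 \<le> imbalance_moment"
    and "ennreal imbalance_moment \<le> ennreal ((r + r')\<^sup>2 / 2 * (1 - 1 / real m)) * (\<integral>\<^sup>+\<omega>. B \<omega> \<partial>M)"
proof -
  define R where "R \<omega> = (\<Sum>w\<in>balanced m p n. wt w \<omega> * (imbalance_part w \<omega> * imbalance_part w \<omega>))" for \<omega>
  have int: "integrable M (\<lambda>\<omega>. wt w \<omega> * (imbalance_part w \<omega> * imbalance_part w \<omega>))" if "w \<in> balanced m p n" for w
    by (intro wt_mult_integrable that imbalance_part_square_integrable)
  then have R_int: "integrable M R" unfolding R_def[abs_def] by simp
  have moment: "imbalance_moment = (\<integral>\<omega>. R \<omega> \<partial>M)"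
    unfolding imbalance_moment_def R_def using int by simp
  have R_eq: "AE \<omega> in M. R \<omega> = design_mean m p n (D (covariates n X \<omega>)) (\<lambda>w. (imbalance_part w \<omega>)\<^sup>2)"
    using AE_wt
  proof eventually_elim
    case (elim \<omega>)
    then show ?case
      unfolding R_def using balanced_assignments by (intro sum.cong) (auto simp: power2_eq_square)
  qed
  then have R_nonneg: "AE \<omega> in M. 0 \<le> R \<omega>"
    by eventually_elim (simp add: sum_nonneg)
  then show "0 \<le> imbalance_moment" unfolding moment by (rule integral_nonneg_AE)
  have R_le: "AE \<omega> in M. ennreal (R \<omega>) \<le> ennreal ((r + r')\<^sup>2 / 2 * (1 - 1 / real m)) * B \<omega>"
    using R_eq AE_space
  proof eventually_elim
    case (elim \<omega>)
    have "eval_diff_continuous F nrm (covariates n X \<omega> i) (covariates n X \<omega> j)"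
      if "i \<in> {1..n}" "j \<in> {1..n}" for i j
      using eval[OF elim(2) that] that by (simp add: covariates_def)
    from group_deviation_difference_le[OF p_pos n_eq F this controls[OF elim(2)] r r' k k' kk']
    show ?case using elim(1) by (simp only: imbalance_part_def)
  qed
  have "1 / real m \<le> 1" using k by simp
  then have c: "(r + r')\<^sup>2 / 2 * (1 - 1 / real m) \<ge> 0" by simp
  have "ennreal imbalance_moment = (\<integral>\<^sup>+\<omega>. ennreal (R \<omega>) \<partial>M)"
    unfolding moment by (rule nn_integral_eq_integral[OF R_int R_nonneg, symmetric])
  also have "\<dots> \<le> ennreal ((r + r')\<^sup>2 / 2 * (1 - 1 / real m)) * (\<integral>\<^sup>+\<omega>. B \<omega> \<partial>M)"
    by (rule nn_integral_le_cmult[OF _ R_le c]) (use R_int in auto)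
  finally show "ennreal imbalance_moment \<le> ennreal ((r + r')\<^sup>2 / 2 * (1 - 1 / real m)) * (\<integral>\<^sup>+\<omega>. B \<omega> \<partial>M)" .
qed

lemma variance_eps: "l \<in> {1..m} \<Longrightarrow> variance (eps 1 l) = (\<integral>\<omega>. (eps 1 l \<omega>)\<^sup>2 \<partial>M)"
  using eps_mean_zero[of 1 l] n_pos by simp

text \<open>
  The outcome difference is the sum of \<open>centered 1\<close>, a residual difference orthogonal to it, and a
  constant; the mixed moment of the two residuals cancels against the one in the variance of their sum.
\<close>

lemma variance_effect_plus_variance_noise:
  "variance (\<lambda>\<omega>. Y 1 k \<omega> - Y 1 k' \<omega>) + variance (\<lambda>\<omega>. eps 1 k \<omega> + eps 1 k' \<omega>)
    = (\<integral>\<omega>. centered 1 \<omega> * centered 1 \<omega> \<partial>M)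
      + 2 * ((\<integral>\<omega>. (eps 1 k \<omega>)\<^sup>2 \<partial>M) + (\<integral>\<omega>. (eps 1 k' \<omega>)\<^sup>2 \<partial>M))"
proof -
  have 1: "1 \<in> {1..n}" using n_pos by simp
  note sq = centered_square_integrable[OF 1] eps_square_integrable[OF 1 k] eps_square_integrable[OF 1 k']
  note int = sq[THEN square_integrable_integrable]
  note zero = centered_mean_zero[OF 1] eps_mean_zero[OF 1 k] eps_mean_zero[OF 1 k']
  have Y: "Y 1 k \<omega> - Y 1 k' \<omega> = centered 1 \<omega> + (eps 1 k \<omega> - eps 1 k' \<omega>) + effect" for \<omega>
    by (simp add: centered_def residual_def)
  have EY: "expectation (\<lambda>\<omega>. Y 1 k \<omega> - Y 1 k' \<omega>) = effect"
    unfolding Y using int zero by (simp add: prob_space)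
  have Ee: "expectation (\<lambda>\<omega>. eps 1 k \<omega> + eps 1 k' \<omega>) = 0"
    using int zero by simp
  have orth: "(\<integral>\<omega>. centered 1 \<omega> * eps 1 l \<omega> \<partial>M) = 0" if l: "l \<in> {1..m}" for l
    by (rule eps_orthogonal[OF 1 l centered_measurable_others[OF 1 1]])
      (rule square_integrable_mult[OF sq(1) eps_square_integrable[OF 1 l]])
  have prods: "integrable M (\<lambda>\<omega>. centered 1 \<omega> * centered 1 \<omega>)" "integrable M (\<lambda>\<omega>. centered 1 \<omega> * eps 1 k \<omega>)"
    "integrable M (\<lambda>\<omega>. centered 1 \<omega> * eps 1 k' \<omega>)" "integrable M (\<lambda>\<omega>. eps 1 k \<omega> * eps 1 k' \<omega>)"
    "integrable M (\<lambda>\<omega>. (eps 1 k \<omega>)\<^sup>2)" "integrable M (\<lambda>\<omega>. (eps 1 k' \<omega>)\<^sup>2)"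
    using square_integrable_mult[OF sq(1) sq(1)] square_integrable_mult[OF sq(1) sq(2)]
      square_integrable_mult[OF sq(1) sq(3)] square_integrable_mult[OF sq(2) sq(3)] sq(2,3)
    by (simp_all add: square_integrable_def)
  have "variance (\<lambda>\<omega>. Y 1 k \<omega> - Y 1 k' \<omega>) = (\<integral>\<omega>. centered 1 \<omega> * centered 1 \<omega>
      + 2 * (centered 1 \<omega> * eps 1 k \<omega>) - 2 * (centered 1 \<omega> * eps 1 k' \<omega>)
      + (eps 1 k \<omega>)\<^sup>2 + (eps 1 k' \<omega>)\<^sup>2 - 2 * (eps 1 k \<omega> * eps 1 k' \<omega>) \<partial>M)"
    unfolding EY unfolding Y
    by (intro Bochner_Integration.integral_cong refl) (simp add: power2_eq_square algebra_simps)
  also have "\<dots> = (\<integral>\<omega>. centered 1 \<omega> * centered 1 \<omega> \<partial>M) + (\<integral>\<omega>. (eps 1 k \<omega>)\<^sup>2 \<partial>M)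
      + (\<integral>\<omega>. (eps 1 k' \<omega>)\<^sup>2 \<partial>M) - 2 * (\<integral>\<omega>. eps 1 k \<omega> * eps 1 k' \<omega> \<partial>M)"
    using prods orth[OF k] orth[OF k'] by simp
  finally have VY: "variance (\<lambda>\<omega>. Y 1 k \<omega> - Y 1 k' \<omega>) = \<dots>" .
  have "variance (\<lambda>\<omega>. eps 1 k \<omega> + eps 1 k' \<omega>)
      = (\<integral>\<omega>. (eps 1 k \<omega>)\<^sup>2 + (eps 1 k' \<omega>)\<^sup>2 + 2 * (eps 1 k \<omega> * eps 1 k' \<omega>) \<partial>M)"
    unfolding Ee by (simp add: power2_sum mult.assoc)
  also have "\<dots> = (\<integral>\<omega>. (eps 1 k \<omega>)\<^sup>2 \<partial>M) + (\<integral>\<omega>. (eps 1 k' \<omega>)\<^sup>2 \<partial>M)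
      + 2 * (\<integral>\<omega>. eps 1 k \<omega> * eps 1 k' \<omega> \<partial>M)"
    using prods by simp
  finally show ?thesis using VY by simp
qed

text \<open>
  The sample and noise moments make up the variance terms of the bound exactly; only the imbalance moment
  is estimated.
\<close>

lemma variance_tau_hat_le_variance_bound:
  assumes F: "normed_function_space F nrm"
    and eval: "\<And>\<omega> i j. \<omega> \<in> space M \<Longrightarrow> i \<in> {1..n} \<Longrightarrow> j \<in> {1..n} \<Longrightarrow>
           eval_diff_continuous F nrm (X i \<omega>) (X j \<omega>)"
    and controls: "\<And>\<omega>. \<omega> \<in> space M \<Longrightarrow>
      controls_imbalance F nrm m p n (covariates n X \<omega>) (D (covariates n X \<omega>)) (B \<omega>)"
  shows "ennreal (variance (tau_hat p n Y W k k')) \<le> variance_bound M F nrm m n X Y f B k k'"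
proof (cases "qnorm F nrm (f k) = \<infinity> \<or> qnorm F nrm (f k') = \<infinity>")
  case False
  obtain r where r: "qnorm F nrm (f k) = ennreal r" "r \<ge> 0"
    using False by (cases "qnorm F nrm (f k)") auto
  obtain r' where r': "qnorm F nrm (f k') = ennreal r'" "r' \<ge> 0"
    using False by (cases "qnorm F nrm (f k')") auto
  note R = imbalance_moment_le[OF F eval controls r r']
  let ?v = "(\<integral>\<omega>. (eps 1 k \<omega>)\<^sup>2 \<partial>M) + (\<integral>\<omega>. (eps 1 k' \<omega>)\<^sup>2 \<partial>M)"
  let ?a = "1 / real n * variance (\<lambda>\<omega>. Y 1 k \<omega> - Y 1 k' \<omega>)"
  let ?b = "1 / real n * variance (\<lambda>\<omega>. eps 1 k \<omega> + eps 1 k' \<omega>)"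
  let ?c = "(real m - 2) / real n * (variance (eps 1 k) + variance (eps 1 k'))"
  have m: "m \<ge> 2" using k k' kk' by (cases "k < k'") auto
  have nonneg: "0 \<le> ?a" "0 \<le> ?b" "0 \<le> ?c"
    using m by (auto intro!: mult_nonneg_nonneg divide_nonneg_nonneg add_nonneg_nonneg variance_positive)
  have "?a + ?b + ?c = (variance (\<lambda>\<omega>. Y 1 k \<omega> - Y 1 k' \<omega>) + variance (\<lambda>\<omega>. eps 1 k \<omega> + eps 1 k' \<omega>)) / real n
      + (real m - 2) / real n * ?v"
    by (simp only: variance_eps[OF k] variance_eps[OF k'] add_divide_distrib) simp
  also have "\<dots> = (\<integral>\<omega>. centered 1 \<omega> * centered 1 \<omega> \<partial>M) / real n + ?v * real m / real n"
    unfolding variance_effect_plus_variance_noise using n_pos by (simp add: field_simps)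
  \<comment> \<open>The coefficient \<open>m/n\<close> arises as \<open>2/n + (m - 2)/n\<close>.\<close>
  also have "?v * real m / real n = ?v / real p"
    using m p_pos by (simp add: n_eq)
  finally have total: "variance (tau_hat p n Y W k k') \<le> ?a + imbalance_moment + ?b + ?c"
    using variance_tau_hat_le by linarith
  have norm: "(qnorm F nrm (f k) + qnorm F nrm (f k'))\<^sup>2 / 2 * ennreal (1 - 1 / real m)
      = ennreal ((r + r')\<^sup>2 / 2 * (1 - 1 / real m))"
  proof -
    have "(qnorm F nrm (f k) + qnorm F nrm (f k'))\<^sup>2 / 2 = ennreal ((r + r')\<^sup>2 / 2)"
      using r r' by (simp add: ennreal_plus[symmetric] ennreal_power divide_ennreal[symmetric] del: ennreal_plus)
    then have "(qnorm F nrm (f k) + qnorm F nrm (f k'))\<^sup>2 / 2 * ennreal (1 - 1 / real m)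
        = ennreal ((r + r')\<^sup>2 / 2) * ennreal (1 - 1 / real m)"
      by (simp only:)
    also have "\<dots> = ennreal ((r + r')\<^sup>2 / 2 * (1 - 1 / real m))"
      by (rule ennreal_mult[symmetric]) (use m in auto)
    finally show ?thesis .
  qed
  have "ennreal (variance (tau_hat p n Y W k k')) \<le> ennreal (?a + imbalance_moment + ?b + ?c)"
    by (rule ennreal_leI[OF total])
  also have "\<dots> = ennreal ?a + ennreal imbalance_moment + ennreal ?b + ennreal ?c"
    using nonneg R(1) by (simp only: ennreal_plus add_nonneg_nonneg)
  also have "\<dots> \<le> ennreal ?a + ennreal ((r + r')\<^sup>2 / 2 * (1 - 1 / real m)) * (\<integral>\<^sup>+\<omega>. B \<omega> \<partial>M)
      + ennreal ?b + ennreal ?c"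
    by (intro add_mono R(2) order_refl)
  also have "\<dots> = variance_bound M F nrm m n X Y f B k k'"
    unfolding variance_bound_def norm using False by simp
  finally show ?thesis .
qed (simp add: variance_bound_def)

end

theorem corollary2:
  fixes M :: "'a measure" and N :: "'x measure"
    and m p n :: nat
    and X :: "nat \<Rightarrow> 'a \<Rightarrow> 'x" and Y :: "nat \<Rightarrow> nat \<Rightarrow> 'a \<Rightarrow> real"
    and f :: "nat \<Rightarrow> 'x \<Rightarrow> real"
    and W :: "'a \<Rightarrow> nat \<Rightarrow> nat"
    and D :: "(nat \<Rightarrow> 'x) \<Rightarrow> (nat \<Rightarrow> nat) pmf"
    and F :: "('x \<Rightarrow> real) set" and nrm :: "('x \<Rightarrow> real) \<Rightarrow> real"
    and k k' :: nat
  assumes "prob_space M"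
    and "space N = UNIV"
    and "m \<ge> 2" and "p \<ge> 1" and "n = m * p"
    and "iid_subjects M N m n X Y"
    and "\<And>i k. i \<in> {1..n} \<Longrightarrow> k \<in> {1..m} \<Longrightarrow> integrable M (\<lambda>\<omega>. (Y i k \<omega>)\<^sup>2)"
    and "\<And>i k. i \<in> {1..n} \<Longrightarrow> k \<in> {1..m} \<Longrightarrow> regression_function M N (Y i k) (X i) (f k)"
    and "normed_function_space F nrm"
    and "complete_mod_const F nrm"
    and "\<And>\<omega> i j. \<omega> \<in> space M \<Longrightarrow> i \<in> {1..n} \<Longrightarrow> j \<in> {1..n} \<Longrightarrow>
           eval_diff_continuous F nrm (X i \<omega>) (X j \<omega>)"
    and "drawn_from_design M N m n X Y W D"
    and "k \<in> {1..m}" and "k' \<in> {1..m}" and "k \<noteq> k'"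
  shows
    "((\<forall>\<omega>\<in>space M. D (covariates n X \<omega>) = PSOD F nrm m p n (covariates n X \<omega>)) \<longrightarrow>
        ennreal (prob_space.variance M (tau_hat p n Y W k k'))
          \<le> variance_bound M F nrm m n X Y f (\<lambda>\<omega>. MP2_opt F nrm m p n (covariates n X \<omega>)) k k') \<and>
     ((\<forall>\<omega>\<in>space M. D (covariates n X \<omega>) \<in> MSODs F nrm m p n (covariates n X \<omega>)) \<longrightarrow>
        ennreal (prob_space.variance M (tau_hat p n Y W k k'))
          \<le> variance_bound M F nrm m n X Y f (\<lambda>\<omega>. MM2_opt F nrm m p n (covariates n X \<omega>)) k k')"
proof -
  interpret iid_sample M N m n X Y f
  proof (intro iid_sample.intro iid_sample_axioms.intro)
    show "n \<ge> 1" using assms(3-5) by (cases m; cases p) auto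
  qed (use assms in auto)
  note decoupled = treatment_comparison.variance_tau_hat_le_variance_bound[OF
      treatment_comparison.intro[OF randomized_experiment.intro[OF iid_sample_axioms
        randomized_experiment_axioms.intro[OF assms(4,5,12)]]
        treatment_comparison_axioms.intro[OF assms(13-15)]] assms(9,11)]
  show ?thesis
  proof (intro conjI impI)
    assume D: "\<forall>\<omega>\<in>space M. D (covariates n X \<omega>) = PSOD F nrm m p n (covariates n X \<omega>)"
    have controls: "controls_imbalance F nrm m p n (covariates n X \<omega>) (D (covariates n X \<omega>))
        (MP2_opt F nrm m p n (covariates n X \<omega>))" if "\<omega> \<in> space M" for \<omega>
      using D that PSOD_controls_imbalance[OF assms(4,5)] by simp
    show "ennreal (variance (tau_hat p n Y W k k'))
        \<le> variance_bound M F nrm m n X Y f (\<lambda>\<omega>. MP2_opt F nrm m p n (covariates n X \<omega>)) k k'"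
      by (rule decoupled) (use controls in \<open>auto simp: controls_imbalance_def\<close>)
  next
    assume D: "\<forall>\<omega>\<in>space M. D (covariates n X \<omega>) \<in> MSODs F nrm m p n (covariates n X \<omega>)"
    have controls: "controls_imbalance F nrm m p n (covariates n X \<omega>) (D (covariates n X \<omega>))
        (MM2_opt F nrm m p n (covariates n X \<omega>))" if "\<omega> \<in> space M" for \<omega>
      using D that MSOD_controls_imbalance by blast
    show "ennreal (variance (tau_hat p n Y W k k'))
        \<le> variance_bound M F nrm m n X Y f (\<lambda>\<omega>. MM2_opt F nrm m p n (covariates n X \<omega>)) k k'"
      by (rule decoupled) (use controls in \<open>auto simp: controls_imbalance_def\<close>)
  qed
qed

end
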